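(* Let $\mathcal M\subset\mathbb R^d$ be a smooth compact submanifold with reach $\tau$, let $\mathbf m\in\mathcal M$, and let $\mathbf v\in N_{\mathbf m}\mathcal M$ be a normal vector with $\|\mathbf v\|_2<\tau$. Let $\mathbf B_{\mathbf v}\colon T_{\mathbf m}\mathcal M\to T_{\mathbf m}\mathcal M$ be the symmetric operator defined by $\langle\mathbf B_{\mathbf v}\mathbf x,\mathbf y\rangle=\langle\mathbf v,\nabla_{\mathbf x}\mathbf y\rangle$ for $\mathbf x,\mathbf y\in T_{\mathbf m}\mathcal M$, extended to $\mathbf B_{\mathbf v}\colon\mathbb R^d\to\mathbb R^d$ by $\mathbf B_{\mathbf v}\mathbf n=\mathbf 0$ for all $\mathbf n\in N_{\mathbf m}\mathcal M$. Then the derivative of the projection operator $P_{\mathcal M}$ satisfies $$\mathrm dP_{\mathcal M}(\mathbf m+\mathbf v)=P_{T_{\mathbf m}\mathcal M}(\mathbf I-\mathbf B_{\mathbf v})^{-1}=\mathrm dP_{\mathcal M}(\mathbf m)+\mathbf B_{\mathbf v}(\mathbf I-\mathbf B_{\mathbf v})^{-1},$$ where $\mathbf I\colon\mathbb R^d\to\mathbb R^d$ is the identity and $P_{T_{\mathbf m}\mathcal M}\colon\mathbb R^d\to T_{\mathbf m}\mathcal M$ is the orthogonal projection.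
   Context: $\mathcal M\subset\mathbb R^d$ is a smooth compact Riemannian submanifold (induced metric) with tangent spaces $T_{\mathbf m}\mathcal M$ and normal spaces $N_{\mathbf m}\mathcal M=(T_{\mathbf m}\mathcal M)^\perp$. Its reach $\tau>0$ is the maximal constant such that $E(\mathbf m,\mathbf v)=\mathbf m+\mathbf v$ is injective on $V=\{(\mathbf m,\mathbf v):\mathbf m\in\mathcal M,\ \mathbf v\in N_{\mathbf m}\mathcal M,\ \|\mathbf v\|_2<\tau\}$; $U=E(V)$ is the tubular neighborhood. On $U$, $P_{\mathcal M}(\mathbf x)=\operatorname{argmin}_{\mathbf m\in\mathcal M}\|\mathbf x-\mathbf m\|_2$ is a well-defined smooth map, and $\mathrm dP_{\mathcal M}$ is its differential. Notation $\nabla_{\mathbf t}\mathbf y$: a vector field $\mathbf Y$ with values in $\mathbb R^d$ along a curve $\gamma$ in $\mathcal M$ is parallel along $\gamma$ if $P_T\frac{\mathrm d}{\mathrm ds}(P_T\mathbf Y)+P_N\frac{\mathrm d}{\mathrm ds}(P_N\mathbf Y)=0$, where $P_T,P_N$ are the orthogonal projections onto $T_{\gamma(s)}\mathcal M$ and $N_{\gamma(s)}\mathcal M$. For $\mathbf t\in T_{\mathbf m}\mathcal M$ and $\mathbf y\in\mathbb R^d$, $\nabla_{\mathbf t}\mathbf y$ denotes the ordinary derivative $\mathbf Y'(0)\in\mathbb R^d$, where $\gamma$ is the geodesic in $\mathcal M$ with $\gamma(0)=\mathbf m$, $\dot\gamma(0)=\mathbf t$, and $\mathbf Y$ is the parallel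 vector field along $\gamma$ with $\mathbf Y(0)=\mathbf y$. (For tangent $\mathbf x,\mathbf y$, $\nabla_{\mathbf x}\mathbf y$ is the second fundamental form of $\mathcal M$ at $\mathbf m$ evaluated on $\mathbf x,\mathbf y$.) *)

theory Defs
  imports "HOL-Analysis.Analysis"
begin

text \<open>Only used on open sets \<open>S\<close>: all iterated directional derivatives up to order \<open>n\<close> exist and
  are continuous there.\<close>

primrec C_on :: "nat \<Rightarrow> 'a::real_normed_vector set \<Rightarrow> ('a \<Rightarrow> 'b::real_normed_vector) \<Rightarrow> bool" where
  "C_on 0 S f \<longleftrightarrow> continuous_on S f"
| "C_on (Suc n) S f \<longleftrightarrow>
     (\<forall>x\<in>S. f differentiable (at x)) \<and> (\<forall>v. C_on n S (\<lambda>x. frechet_derivative f (at x) v))"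

definition smooth_on :: "'a::real_normed_vector set \<Rightarrow> ('a \<Rightarrow> 'b::real_normed_vector) \<Rightarrow> bool" where
  "smooth_on S f \<longleftrightarrow> (\<forall>n. C_on n S f)"

text \<open>Embedded submanifolds without boundary, via slice charts: near each of its points, \<open>M\<close> is
  carried to a piece of a \<open>k\<close>-dimensional linear subspace by a diffeomorphism between open sets of
  the ambient space.\<close>

definition smooth_submanifold :: "nat \<Rightarrow> 'a::euclidean_space set \<Rightarrow> bool" where
  "smooth_submanifold k M \<longleftrightarrow>
     (\<forall>p\<in>M. \<exists>U W (\<phi>::'a \<Rightarrow> 'a) (\<psi>::'a \<Rightarrow> 'a) L. open U \<and> p \<in> U \<and> open W \<and> homeomorphism U W \<phi> \<psi> \<and>
        smooth_on U \<phi> \<and> smooth_on W \<psi> \<and> subspace L \<and> dim L = k \<and> \<phi> ` (M \<inter> U) = L \<inter> W)"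

definition tangent_space_at :: "'a::euclidean_space set \<Rightarrow> 'a \<Rightarrow> 'a set" where
  "tangent_space_at M m =
     {t. \<exists>\<epsilon>>0. \<exists>\<gamma>::real \<Rightarrow> 'a. smooth_on {-\<epsilon><..<\<epsilon>} \<gamma> \<and> \<gamma> ` {-\<epsilon><..<\<epsilon>} \<subseteq> M \<and> \<gamma> 0 = m \<and>
           (\<gamma> has_vector_derivative t) (at 0)}"

definition normal_space_at :: "'a::euclidean_space set \<Rightarrow> 'a \<Rightarrow> 'a set" where
  "normal_space_at M m = orthogonal_comp (tangent_space_at M m)"

definition orth_proj :: "'a::euclidean_space set \<Rightarrow> 'a \<Rightarrow> 'a" where
  "orth_proj S x = (THE y. y \<in> S \<and> x - y \<in> orthogonal_comp S)"

definition normal_tube :: "'a::euclidean_space set \<Rightarrow> real \<Rightarrow> ('a \<times> 'a) set" where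
  "normal_tube M \<tau> = {(p, u). p \<in> M \<and> u \<in> normal_space_at M p \<and> norm u < \<tau>}"

text \<open>Since the tubes increase in \<open>\<tau>\<close> and are cut off by a strict inequality, a finite supremum is attained and is thus the
  maximal admissible constant. The value is \<open>\<infinity>\<close> when there is no bound, as for a single point.\<close>

definition reach :: "'a::euclidean_space set \<Rightarrow> ereal" where
  "reach M = (SUP \<tau>\<in>{\<tau>. 0 < \<tau> \<and> inj_on (\<lambda>(p, u). p + u) (normal_tube M \<tau>)}. ereal \<tau>)"

definition parallel_along ::
  "'a::euclidean_space set \<Rightarrow> real set \<Rightarrow> (real \<Rightarrow> 'a) \<Rightarrow> (real \<Rightarrow> 'a) \<Rightarrow> bool" where
  "parallel_along M J \<gamma> Y \<longleftrightarrow>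
     (\<forall>s\<in>J. \<exists>a b.
        ((\<lambda>r. orth_proj (tangent_space_at M (\<gamma> r)) (Y r)) has_vector_derivative a) (at s) \<and>
        ((\<lambda>r. orth_proj (normal_space_at M (\<gamma> r)) (Y r)) has_vector_derivative b) (at s) \<and>
        orth_proj (tangent_space_at M (\<gamma> s)) a + orth_proj (normal_space_at M (\<gamma> s)) b = 0)"

text \<open>Geodesics of the induced metric are the curves whose velocity is parallel: the normal part of
  the velocity vanishes, so the condition says that the tangential part of the acceleration is zero.
  Solutions of this equation are automatically smooth.\<close>

definition geodesic_on :: "'a::euclidean_space set \<Rightarrow> real set \<Rightarrow> (real \<Rightarrow> 'a) \<Rightarrow> bool" where
  "geodesic_on M J \<gamma> \<longleftrightarrow>
     (\<exists>\<gamma>'. (\<forall>s\<in>J. \<gamma> s \<in> M \<and> (\<gamma> has_vector_derivative \<gamma>' s) (at s)) \<and> parallel_along M J \<gamma> \<gamma>')"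

definition nabla :: "'a::euclidean_space set \<Rightarrow> 'a \<Rightarrow> 'a \<Rightarrow> 'a \<Rightarrow> 'a" where
  "nabla M m t y =
     (THE w. \<exists>\<epsilon>>0. \<exists>\<gamma> Y. geodesic_on M {-\<epsilon><..<\<epsilon>} \<gamma> \<and> \<gamma> 0 = m \<and> (\<gamma> has_vector_derivative t) (at 0) \<and>
        parallel_along M {-\<epsilon><..<\<epsilon>} \<gamma> Y \<and> Y 0 = y \<and> (Y has_vector_derivative w) (at 0))"

definition is_shape_operator :: "'a::euclidean_space set \<Rightarrow> 'a \<Rightarrow> 'a \<Rightarrow> ('a \<Rightarrow> 'a) \<Rightarrow> bool" where
  "is_shape_operator M m v B \<longleftrightarrow>
     linear B \<and> B ` tangent_space_at M m \<subseteq> tangent_space_at M m \<and>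
     (\<forall>x\<in>tangent_space_at M m. \<forall>y\<in>tangent_space_at M m. B x \<bullet> y = v \<bullet> nabla M m x y) \<and>
     (\<forall>n\<in>normal_space_at M m. B n = 0)"

definition shape_operator :: "'a::euclidean_space set \<Rightarrow> 'a \<Rightarrow> 'a \<Rightarrow> 'a \<Rightarrow> 'a" where
  "shape_operator M m v = (THE B. is_shape_operator M m v B)"

end

theory Submission
  imports Defs
begin

text \<open>In a slice chart \<open>\<psi>\<close> of \<open>M\<close> near \<open>m\<close>, a curve is \<open>\<psi> \<circ> c\<close> and a tangent field along it is
  \<open>D\<psi>(c) e\<close>; differentiating shows that \<open>nabla M m\<close> is the normal part of \<open>D\<^sup>2\<psi>(c)\<close>, the existence of
  the required geodesic and parallel field being a case of the Picard-Lindeloef theorem. Symmetry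
  of the shape operator \<open>B\<close> is then symmetry of second derivatives. Injectivity of \<open>(p, u) \<mapsto> p + u\<close> on
  the tube forces \<open>m\<close> to be the unique closest point to \<open>m + s v\<close> even for some \<open>s > 1\<close>, and the second
  order condition at this minimum gives \<open>s \<langle>B t, t\<rangle> \<le> \<langle>t, t\<rangle>\<close>, so \<open>I - B\<close> is invertible. Finally,
  \<open>(p, u) \<mapsto> p + u\<close>, read in coordinates, has an invertible derivative, and \<open>closest_point M\<close> yields a
  continuous right inverse near \<open>m + v\<close>; hence it is differentiable there, and its
  derivative can be read off.\<close>

section \<open>Iterated directional derivatives\<close>

text \<open>\<open>C_on\<close> provides derivatives along one fixed direction at a time, so
  linearity, uniformity and dependence on a varying direction all go through an expansion over
  \<open>Basis\<close>. \<open>nabla\<close> is a definite description over all geodesics and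
  parallel fields with given initial data: a pair has to exist, and all pairs have to yield the same
  derivative at 0. For existence the obstacle is that the coefficient of the geodesic equation
  contains the orthogonal projection onto a moving tangent space, whose Lipschitz dependence has to
  be shown. The number \<open>s > 1\<close> comes from the strict inequality between the norm of
  \<open>v\<close> and the reach; at \<open>s = 1\<close> the form of \<open>I - B\<close> would be
  known only to be nonnegative, which leaves room for a kernel. The map
  \<open>(p, u) \<mapsto> p + u\<close> becomes a map of the ambient space to itself, the normal
  space being transported from the orthogonal complement of \<open>L\<close> by an adjoint; its
  derivative is then a square linear map, invertible once injective. \<open>B\<close> enters this
  derivative through the motion of the normal space with its foot point.\<close>

abbreviation Dir :: "('a::real_normed_vector \<Rightarrow> 'b::real_normed_vector) \<Rightarrow> 'a \<Rightarrow> 'a \<Rightarrow> 'b" where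
  "Dir f x v \<equiv> frechet_derivative f (at x) v"

abbreviation Dir2 :: "('a::real_normed_vector \<Rightarrow> 'b::real_normed_vector) \<Rightarrow> 'a \<Rightarrow> 'a \<Rightarrow> 'a \<Rightarrow> 'b" where
  "Dir2 f x v w \<equiv> frechet_derivative (\<lambda>z. frechet_derivative f (at z) v) (at x) w"

lemma C_on_has_derivative:
  assumes "C_on (Suc n) S f" "x \<in> S"
  shows "(f has_derivative Dir f x) (at x)"
  using assms by (auto simp: frechet_derivative_works[symmetric])

lemma C_on_Dir: "C_on (Suc n) S f \<Longrightarrow> C_on n S (\<lambda>x. Dir f x v)"
  by simp

lemma C_on_imp_continuous_on: "C_on n S f \<Longrightarrow> continuous_on S f"
  by (cases n) (auto intro!: continuous_at_imp_continuous_on differentiable_imp_continuous_within)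

lemma linear_Dir: "C_on (Suc n) S f \<Longrightarrow> x \<in> S \<Longrightarrow> linear (Dir f x)"
  by (simp add: linear_frechet_derivative)

text \<open>On an open set, agreement near a point carries over to the derivative, hence to every
  iterated one. Explicit formulas for derivatives hold only on \<open>S\<close>, so the induction
  compares functions that agree there.\<close>

lemma C_on_cong:
  assumes "C_on n S f" "open S" "\<And>x. x \<in> S \<Longrightarrow> f x = g x"
  shows "C_on n S g"
  using assms
proof (induction n arbitrary: f g)
  case 0
  then show ?case by (simp cong: continuous_on_cong)
next
  case (Suc n)
  have d: "(g has_derivative Dir f x) (at x)" if "x \<in> S" for x
    using has_derivative_transform_within_open[OF C_on_has_derivative[OF Suc.prems(1) that]
        Suc.prems(2) that Suc.prems(3)] .
  have e: "Dir f x v = Dir g x v" if "x \<in> S" for x v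
    using frechet_derivative_at[OF d[OF that]] by simp
  show ?case
    using d Suc.IH[OF C_on_Dir[OF Suc.prems(1)] Suc.prems(2) e]
    by (auto simp: differentiable_def)
qed

text \<open>The factor \<open>r\<close> makes the induction close up: differentiating along the line
  in direction \<open>h\<close> reproduces the same shape with the derivative of \<open>f\<close>
  along \<open>l\<close> for \<open>f\<close> and \<open>h * r\<close> for \<open>r\<close>. It
  yields the smooth curves in the description of the tangent space.\<close>

lemma C_on_scaleR_line:
  fixes f :: "'a::real_normed_vector \<Rightarrow> 'b::real_normed_vector"
  assumes "C_on n S f" "open J" "\<And>s. s \<in> J \<Longrightarrow> a + s *\<^sub>R l \<in> S"
  shows "C_on n J (\<lambda>s. r *\<^sub>R f (a + s *\<^sub>R l))"
  using assms
proof (induction n arbitrary: f r)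
  case 0
  have "continuous_on J (f \<circ> (\<lambda>s. a + s *\<^sub>R l))"
    by (rule continuous_on_compose)
       (use 0 in \<open>auto intro!: continuous_intros elim: continuous_on_subset\<close>)
  then show ?case by (auto intro!: continuous_intros simp: o_def)
next
  case (Suc n)
  have d: "((\<lambda>s. r *\<^sub>R f (a + s *\<^sub>R l)) has_derivative (\<lambda>h. r *\<^sub>R Dir f (a + s *\<^sub>R l) (h *\<^sub>R l))) (at s)"
    if "s \<in> J" for s
    by (rule has_derivative_scaleR_right, rule has_derivative_compose[where f="\<lambda>s. a + s *\<^sub>R l" and g=f])
       (auto intro!: derivative_eq_intros C_on_has_derivative[OF Suc.prems(1) Suc.prems(3)[OF that]])
  have e: "(h * r) *\<^sub>R Dir f (a + s *\<^sub>R l) l = Dir (\<lambda>s. r *\<^sub>R f (a + s *\<^sub>R l)) s h" if "s \<in> J" for s h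
    using fun_cong[OF frechet_derivative_at[OF d[OF that]], of h]
    by (simp only: linear_cmul[OF linear_Dir[OF Suc.prems(1) Suc.prems(3)[OF that]]] scaleR_scaleR mult.commute)
  have "C_on n J (\<lambda>s. Dir (\<lambda>s. r *\<^sub>R f (a + s *\<^sub>R l)) s h)" for h
    by (rule C_on_cong[OF Suc.IH[OF C_on_Dir[OF Suc.prems(1), where v=l] Suc.prems(2,3), where r="h * r"] Suc.prems(2) e])
  then show ?case
    using d by (auto simp: differentiable_def)
qed

lemma linear_sum_basis:
  fixes f :: "'a::euclidean_space \<Rightarrow> 'b::real_vector"
  assumes "linear f"
  shows "f v = (\<Sum>b\<in>Basis. (v \<bullet> b) *\<^sub>R f b)"
proof -
  have "f v = f (\<Sum>b\<in>Basis. (v \<bullet> b) *\<^sub>R b)" by (simp add: euclidean_representation)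
  then show ?thesis using assms by (simp only: linear_sum linear_cmul)
qed

text \<open>Base point and direction move together here, while \<open>C_on\<close> differentiates
  \<open>Dir f x v\<close> in \<open>x\<close> for fixed \<open>v\<close>. Expanding the direction
  over \<open>Basis\<close> reduces this to the product rule.\<close>

lemma has_derivative_Dir:
  fixes f :: "'a::euclidean_space \<Rightarrow> 'b::real_normed_vector"
  assumes f: "C_on (Suc (Suc n)) S f" "open S" "c z \<in> S"
    and c: "(c has_derivative c') (at z)" and e: "(e has_derivative e') (at z)"
  shows "((\<lambda>z. Dir f (c z) (e z)) has_derivative
           (\<lambda>h. Dir2 f (c z) (e z) (c' h) + Dir f (c z) (e' h))) (at z)"
proof -
  have d: "((\<lambda>x. Dir f x v) has_derivative Dir2 f x v) (at x)" if "x \<in> S" for x v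
    using C_on_has_derivative[OF C_on_Dir[OF f(1)] that] .
  have lin: "linear (Dir f x)" if "x \<in> S" for x using linear_Dir[OF f(1) that] .
  have s: "Dir f x v = (\<Sum>b\<in>Basis. (v \<bullet> b) *\<^sub>R Dir f x b)" if "x \<in> S" for x v
    by (rule linear_sum_basis[OF lin[OF that]])
  have s2: "Dir2 f x v w = (\<Sum>b\<in>Basis. (v \<bullet> b) *\<^sub>R Dir2 f x b w)" if "x \<in> S" for x v w
  proof -
    have "((\<lambda>x. Dir f x v) has_derivative (\<lambda>w. \<Sum>b\<in>Basis. (v \<bullet> b) *\<^sub>R Dir2 f x b w)) (at x)"
      by (rule has_derivative_transform_within_open[OF _ f(2) that s[symmetric]])
         (auto intro!: derivative_eq_intros d that)
    from has_derivative_unique[OF d[OF that] this] show ?thesis by simp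
  qed
  have "((\<lambda>z. \<Sum>b\<in>Basis. (e z \<bullet> b) *\<^sub>R Dir f (c z) b) has_derivative
      (\<lambda>h. \<Sum>b\<in>Basis. (e z \<bullet> b) *\<^sub>R Dir2 f (c z) b (c' h) + (e' h \<bullet> b) *\<^sub>R Dir f (c z) b)) (at z)"
    by (intro has_derivative_sum has_derivative_scaleR has_derivative_inner_left e
        has_derivative_compose[OF c d[OF f(3)]])
  also have "(\<lambda>h. \<Sum>b\<in>Basis. (e z \<bullet> b) *\<^sub>R Dir2 f (c z) b (c' h) + (e' h \<bullet> b) *\<^sub>R Dir f (c z) b)
     = (\<lambda>h. Dir2 f (c z) (e z) (c' h) + Dir f (c z) (e' h))"
    unfolding sum.distrib s[OF f(3), of "e' _", symmetric] s2[OF f(3), of "e z", symmetric] ..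
  finally show ?thesis
  proof (rule has_derivative_transform_eventually)
    have "isCont c z" using c has_derivative_continuous by blast
    then have "eventually (\<lambda>z. c z \<in> S) (at z)"
      using f(2,3) by (simp add: isCont_def topological_tendstoD)
    then show "eventually (\<lambda>z. (\<Sum>b\<in>Basis. (e z \<bullet> b) *\<^sub>R Dir f (c z) b) = Dir f (c z) (e z)) (at z)"
      by eventually_elim (metis s)
  qed (simp_all add: s[OF f(3), symmetric])
qed

text \<open>The argument \<open>v\<close> sits inside the inner derivative, so the linearity is that
  of \<open>Dir f x\<close> at all points of \<open>S\<close>, carried through the outer derivative
  by its uniqueness.\<close>

lemma linear_Dir2_left:
  fixes f :: "'a::euclidean_space \<Rightarrow> 'b::real_normed_vector"
  assumes f: "C_on (Suc (Suc n)) S f" "open S" "x \<in> S"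
  shows "linear (\<lambda>v. Dir2 f x v w)"
proof -
  have d: "((\<lambda>x. Dir f x v) has_derivative Dir2 f x v) (at x)" for v
    using C_on_has_derivative[OF C_on_Dir[OF f(1)] f(3)] .
  have lin: "linear (Dir f x)" if "x \<in> S" for x using linear_Dir[OF f(1) that] .
  show ?thesis
  proof
    fix u v :: 'a and r :: real
    have "((\<lambda>x. Dir f x (u + v)) has_derivative (\<lambda>w. Dir2 f x u w + Dir2 f x v w)) (at x)"
      by (rule has_derivative_transform_within_open[OF has_derivative_add[OF d d] f(2,3)])
         (simp add: lin linear_add)
    from has_derivative_unique[OF d this]
    show "Dir2 f x (u + v) w = Dir2 f x u w + Dir2 f x v w" by metis
    have "((\<lambda>x. Dir f x (r *\<^sub>R u)) has_derivative (\<lambda>w. r *\<^sub>R Dir2 f x u w)) (at x)"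
      by (rule has_derivative_transform_within_open[OF has_derivative_scaleR_right[OF d] f(2,3)])
         (simp add: lin linear_cmul)
    from has_derivative_unique[OF d this]
    show "Dir2 f x (r *\<^sub>R u) w = r *\<^sub>R Dir2 f x u w" by metis
  qed
qed

lemma linear_Dir2_right:
  assumes f: "C_on (Suc (Suc n)) S f" "x \<in> S"
  shows "linear (Dir2 f x v)"
  using linear_Dir[OF C_on_Dir[OF f(1)] f(2)] .

text \<open>Both iterated derivatives are limits of the same second difference quotient.\<close>

lemma second_difference_mvt:
  fixes f :: "'a::euclidean_space \<Rightarrow> real"
  assumes f: "C_on (Suc (Suc n)) S f" and h: "0 < h"
    and sub: "\<And>s t. 0 \<le> s \<Longrightarrow> s \<le> h \<Longrightarrow> 0 \<le> t \<Longrightarrow> t \<le> h \<Longrightarrow> x + s *\<^sub>R v + t *\<^sub>R w \<in> S"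
  shows "\<exists>s t. 0 < s \<and> s < h \<and> 0 < t \<and> t < h \<and>
    f (x + h *\<^sub>R v + h *\<^sub>R w) - f (x + h *\<^sub>R v) - f (x + h *\<^sub>R w) + f x
      = h * h * Dir2 f (x + s *\<^sub>R v + t *\<^sub>R w) v w"
proof -
  have real: "(g has_real_derivative D 1) (at s)" if "(g has_derivative D) (at s)" for g D s
  proof (rule has_derivative_imp_has_field_derivative[OF that])
    show "r * D 1 = D r" for r
      using linear_cmul[OF has_derivative_linear[OF that], of r 1]
      by (simp only: real_scaleR_def mult_1_right)
  qed
  \<comment> \<open>The second difference is \<open>g h - g 0\<close>; one mean value step along
    \<open>v\<close> and one along \<open>w\<close> turn it into a mixed derivative.\<close>
  define g where "g s = f (x + s *\<^sub>R v + h *\<^sub>R w) - f (x + s *\<^sub>R v)" for s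
  have line: "((\<lambda>s. k (y + s *\<^sub>R u)) has_real_derivative Dir k (y + s *\<^sub>R u) u) (at s)"
    if "C_on (Suc n) S k" "y + s *\<^sub>R u \<in> S" for k :: "'a \<Rightarrow> real" and y u s n
  proof -
    have "((\<lambda>s. y + s *\<^sub>R u) has_derivative (\<lambda>h. h *\<^sub>R u)) (at s)"
      by (auto intro!: derivative_eq_intros)
    from real[OF has_derivative_compose[OF this C_on_has_derivative[OF that]]] show ?thesis by simp
  qed
  have "(g has_real_derivative Dir f (x + s *\<^sub>R v + h *\<^sub>R w) v - Dir f (x + s *\<^sub>R v) v) (at s)"
    if "0 \<le> s" "s \<le> h" for s
  proof -
    have "(\<lambda>s. f (x + s *\<^sub>R v + h *\<^sub>R w)) = (\<lambda>s. f ((x + h *\<^sub>R w) + s *\<^sub>R v))" by (simp add: algebra_simps)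
    then have "((\<lambda>s. f (x + s *\<^sub>R v + h *\<^sub>R w)) has_real_derivative Dir f (x + s *\<^sub>R v + h *\<^sub>R w) v) (at s)"
      using line[OF f, of "x + h *\<^sub>R w" s v] sub[of s h] that h by (simp add: algebra_simps)
    moreover have "((\<lambda>s. f (x + s *\<^sub>R v)) has_real_derivative Dir f (x + s *\<^sub>R v) v) (at s)"
      using line[OF f, of x s v] sub[of s 0] that h by simp
    ultimately show ?thesis unfolding g_def by (rule DERIV_diff)
  qed
  from MVT2[OF h this] obtain s where s: "0 < s" "s < h"
    "g h - g 0 = h * (Dir f (x + s *\<^sub>R v + h *\<^sub>R w) v - Dir f (x + s *\<^sub>R v) v)" by auto
  have "((\<lambda>t. Dir f (x + s *\<^sub>R v + t *\<^sub>R w) v) has_real_derivative Dir2 f (x + s *\<^sub>R v + t *\<^sub>R w) v w) (at t)"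
    if "0 \<le> t" "t \<le> h" for t
    using line[OF C_on_Dir[OF f], of "x + s *\<^sub>R v" t w v] sub[of s t] that s by simp
  from MVT2[OF h this] obtain t where t: "0 < t" "t < h"
    "Dir f (x + s *\<^sub>R v + h *\<^sub>R w) v - Dir f (x + s *\<^sub>R v) v = h * Dir2 f (x + s *\<^sub>R v + t *\<^sub>R w) v w"
    by auto
  show ?thesis
    using s t by (intro exI[of _ s] exI[of _ t]) (simp add: g_def algebra_simps)
qed

lemma Dir2_symmetric_real:
  fixes f :: "'a::euclidean_space \<Rightarrow> real"
  assumes f: "C_on 2 S f" and S: "open S" "x \<in> S"
  shows "Dir2 f x v w = Dir2 f x w v"
proof (rule dense_eq0_I[of "Dir2 f x v w - Dir2 f x w v", simplified])
  fix \<epsilon> :: real assume e: "0 < \<epsilon>"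
  have f2: "C_on (Suc (Suc 0)) S f" using f by (simp add: numeral_2_eq_2)
  have cont: "isCont (\<lambda>x. Dir2 f x v w) x" for v w
    using C_on_imp_continuous_on[OF C_on_Dir[OF C_on_Dir[OF f2]]] S by (simp add: continuous_on_eq_continuous_at)
  obtain r where r: "r > 0" "ball x r \<subseteq> S" using S openE by blast
  have near: "\<exists>d>0. \<forall>y. dist y x < d \<longrightarrow> \<bar>Dir2 f y v w - Dir2 f x v w\<bar> < \<epsilon>/2" for v w
    using cont[of v w] e unfolding continuous_at_eps_delta dist_real_def
    by (meson half_gt_zero)
  obtain d1 where d1: "d1 > 0" "\<And>y. dist y x < d1 \<Longrightarrow> \<bar>Dir2 f y v w - Dir2 f x v w\<bar> < \<epsilon>/2"
    using near[of v w] by blast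
  obtain d2 where d2: "d2 > 0" "\<And>y. dist y x < d2 \<Longrightarrow> \<bar>Dir2 f y w v - Dir2 f x w v\<bar> < \<epsilon>/2"
    using near[of w v] by blast
  define d where "d = min r (min d1 d2)"
  \<comment> \<open>Small enough that the parallelogram spanned at \<open>x\<close> by
    \<open>h *\<^sub>R v\<close> and \<open>h *\<^sub>R w\<close> stays within distance
    \<open>d\<close>; the summand 1 covers \<open>v = w = 0\<close>.\<close>
  define h where "h = d / (2 * (norm v + norm w + 1))"
  have d: "d > 0" using r d1 d2 by (simp add: d_def)
  have nv: "norm v + norm w + 1 > 0" by (smt (verit) norm_ge_zero)
  have h: "h > 0" using d nv by (simp add: h_def)
  have small: "dist (x + s *\<^sub>R v + t *\<^sub>R w) x < d" if "0 \<le> s" "s \<le> h" "0 \<le> t" "t \<le> h" for s t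
  proof -
    have "dist (x + s *\<^sub>R v + t *\<^sub>R w) x \<le> s * norm v + t * norm w"
      using that norm_triangle_ineq[of "s *\<^sub>R v" "t *\<^sub>R w"] by (simp add: dist_norm)
    also have "\<dots> \<le> h * norm v + h * norm w"
      using that by (intro add_mono mult_right_mono) auto
    also have "\<dots> < h * (2 * (norm v + norm w + 1))"
      using h mult_nonneg_nonneg[of h "norm v"] mult_nonneg_nonneg[of h "norm w"] by (simp add: algebra_simps add_nonneg_pos)
    also have "\<dots> = d" using nv by (simp add: h_def)
    finally show ?thesis .
  qed
  have sub: "x + s *\<^sub>R v + t *\<^sub>R w \<in> S" if "0 \<le> s" "s \<le> h" "0 \<le> t" "t \<le> h" for s t
    using small[OF that] r by (auto simp: d_def dist_commute)
  obtain s t where st: "0 < s" "s < h" "0 < t" "t < h"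
    "f (x + h *\<^sub>R v + h *\<^sub>R w) - f (x + h *\<^sub>R v) - f (x + h *\<^sub>R w) + f x
      = h * h * Dir2 f (x + s *\<^sub>R v + t *\<^sub>R w) v w"
    using second_difference_mvt[OF f2 h, of x v w, OF sub] by blast
  have sub': "x + s *\<^sub>R w + t *\<^sub>R v \<in> S" if "0 \<le> s" "s \<le> h" "0 \<le> t" "t \<le> h" for s t
    using sub[of t s] that by (simp add: algebra_simps)
  obtain s' t' where st': "0 < s'" "s' < h" "0 < t'" "t' < h"
    "f (x + h *\<^sub>R w + h *\<^sub>R v) - f (x + h *\<^sub>R w) - f (x + h *\<^sub>R v) + f x
      = h * h * Dir2 f (x + s' *\<^sub>R w + t' *\<^sub>R v) w v"
    using second_difference_mvt[OF f2 h, of x w v, OF sub'] by blast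
  have "h * h * Dir2 f (x + s *\<^sub>R v + t *\<^sub>R w) v w = h * h * Dir2 f (x + s' *\<^sub>R w + t' *\<^sub>R v) w v"
    using st(5) st'(5) by (simp add: algebra_simps)
  then have "Dir2 f (x + s *\<^sub>R v + t *\<^sub>R w) v w = Dir2 f (x + s' *\<^sub>R w + t' *\<^sub>R v) w v" using h by simp
  moreover have "\<bar>Dir2 f (x + s *\<^sub>R v + t *\<^sub>R w) v w - Dir2 f x v w\<bar> < \<epsilon>/2"
    using small[of s t] st by (intro d1) (auto simp: d_def)
  moreover have "\<bar>Dir2 f (x + s' *\<^sub>R w + t' *\<^sub>R v) w v - Dir2 f x w v\<bar> < \<epsilon>/2"
    using small[of t' s'] st' by (intro d2) (auto simp: d_def algebra_simps)
  ultimately show "\<bar>Dir2 f x v w - Dir2 f x w v\<bar> \<le> \<epsilon>" by linarith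
qed

lemma Dir_inner:
  assumes "f differentiable at x"
  shows "Dir (\<lambda>x. b \<bullet> f x) x v = b \<bullet> Dir f x v"
proof -
  have "((\<lambda>x. b \<bullet> f x) has_derivative (\<lambda>v. b \<bullet> Dir f x v)) (at x)"
    using assms by (intro has_derivative_inner_right) (simp add: frechet_derivative_works[symmetric])
  from frechet_derivative_at[OF this] show ?thesis by metis
qed

lemma C_on_inner:
  fixes f :: "'a::real_normed_vector \<Rightarrow> 'b::real_inner"
  assumes "C_on n S f" "open S" shows "C_on n S (\<lambda>x. b \<bullet> f x)"
  using assms
proof (induction n arbitrary: f)
  case (Suc n)
  have "C_on n S (\<lambda>x. Dir (\<lambda>x. b \<bullet> f x) x v)" for v
    by (rule C_on_cong[OF Suc.IH[OF C_on_Dir[OF Suc.prems(1)] Suc.prems(2)] Suc.prems(2)])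
       (use Suc.prems in \<open>simp add: Dir_inner\<close>)
  moreover have "(\<lambda>x. b \<bullet> f x) differentiable at x" if "x \<in> S" for x
    using Suc.prems that by (intro differentiable_inner differentiable_const) auto
  ultimately show ?case by simp
qed (auto intro: continuous_intros)

text \<open>The mean value theorem as an equality is false for vector values, so the identity is
  tested against each basis vector.\<close>

lemma Dir2_symmetric:
  fixes f :: "'a::euclidean_space \<Rightarrow> 'b::euclidean_space"
  assumes f: "C_on 2 S f" and S: "open S" "x \<in> S"
  shows "Dir2 f x v w = Dir2 f x w v"
proof (rule euclidean_eqI)
  fix b :: 'b
  have f2: "C_on (Suc (Suc 0)) S f" using f by (simp add: numeral_2_eq_2)
  have "b \<bullet> Dir2 f x v w = Dir2 (\<lambda>x. b \<bullet> f x) x v w" for v w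
  proof -
    have "b \<bullet> Dir2 f x v w = Dir (\<lambda>x. b \<bullet> Dir f x v) x w"
      by (rule Dir_inner[symmetric]) (use f2 S in auto)
    also have "\<dots> = Dir2 (\<lambda>x. b \<bullet> f x) x v w"
      by (rule arg_cong[where f="\<lambda>g. g w"], rule frechet_derivative_transform_within_open[OF _ S])
         (use f2 S in \<open>auto intro!: differentiable_inner differentiable_const simp: Dir_inner\<close>)
    finally show ?thesis .
  qed
  then have "b \<bullet> Dir2 f x v w = b \<bullet> Dir2 f x w v"
    using Dir2_symmetric_real[OF C_on_inner[OF f S(1)] S, of b v w] by simp
  then show "Dir2 f x v w \<bullet> b = Dir2 f x w v \<bullet> b" by (simp only: inner_commute)
qed

section \<open>Uniform bounds and Lipschitz estimates for first and second derivatives\<close>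

text \<open>A linear map is controlled by its values on finitely many basis vectors, so bounds for
  each fixed direction become uniform in the direction. The index \<open>i\<close> collects points
  and further directions; \<open>r i\<close> is the scale, such as a distance, to which the bound is
  proportional.\<close>

lemma linear_family_bound:
  fixes G :: "'i \<Rightarrow> 'a::euclidean_space \<Rightarrow> 'b::real_normed_vector"
  assumes lin: "\<And>i. i \<in> I \<Longrightarrow> linear (G i)"
    and bd: "\<And>b. b \<in> Basis \<Longrightarrow> \<exists>K\<ge>0. \<forall>i\<in>I. norm (G i b) \<le> K * r i"
    and r: "\<And>i. i \<in> I \<Longrightarrow> 0 \<le> r i"
  shows "\<exists>K\<ge>0. \<forall>i\<in>I. \<forall>v. norm (G i v) \<le> K * r i * norm v"
proof -
  obtain K where K: "\<And>b. b \<in> Basis \<Longrightarrow> 0 \<le> K b" "\<And>b i. b \<in> Basis \<Longrightarrow> i \<in> I \<Longrightarrow> norm (G i b) \<le> K b * r i"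
    using bd by metis
  have "norm (G i v) \<le> (\<Sum>b\<in>Basis. K b) * r i * norm v" if "i \<in> I" for i v
  proof -
    have "norm (G i v) = norm (\<Sum>b\<in>Basis. (v \<bullet> b) *\<^sub>R G i b)"
      using linear_sum_basis[OF lin[OF that], of v] by simp
    also have "\<dots> \<le> (\<Sum>b\<in>Basis. norm v * (K b * r i))"
      using K that by (intro sum_norm_le) (auto intro!: mult_mono simp: Basis_le_norm)
    also have "\<dots> = (\<Sum>b\<in>Basis. K b) * r i * norm v"
      by (simp add: sum_distrib_left sum_distrib_right mult_ac)
    finally show ?thesis .
  qed
  then show ?thesis using K by (intro exI[of _ "\<Sum>b\<in>Basis. K b"]) (auto intro: sum_nonneg)
qed

lemma C_on_bounded_compact:
  fixes f :: "'a::euclidean_space \<Rightarrow> 'b::real_normed_vector"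
  assumes "C_on n S f" "compact X" "X \<subseteq> S"
  shows "\<exists>K\<ge>0. \<forall>x\<in>X. norm (f x) \<le> K"
proof -
  have "compact (f ` X)"
    using continuous_on_subset[OF C_on_imp_continuous_on[OF assms(1)] assms(3)] assms(2)
    by (rule compact_continuous_image)
  then obtain K where "\<forall>x\<in>X. norm (f x) \<le> K"
    using compact_imp_bounded bounded_iff by (metis imageI)
  then show ?thesis by (intro exI[of _ "max K 0"]) auto
qed

lemma Dir_bound_compact:
  fixes f :: "'a::euclidean_space \<Rightarrow> 'b::real_normed_vector"
  assumes f: "C_on (Suc n) S f" "compact X" "X \<subseteq> S"
  shows "\<exists>K\<ge>0. \<forall>x\<in>X. \<forall>v. norm (Dir f x v) \<le> K * norm v"
proof -
  have "\<exists>K\<ge>0. \<forall>x\<in>X. \<forall>v. norm (Dir f x v) \<le> K * 1 * norm v"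
  proof (rule linear_family_bound)
    show "linear (Dir f x)" if "x \<in> X" for x
      using linear_Dir[OF f(1)] f(3) that by blast
    show "\<exists>K\<ge>0. \<forall>x\<in>X. norm (Dir f x b) \<le> K * 1" for b
      using C_on_bounded_compact[OF C_on_Dir[OF f(1)] f(2,3), of b] by simp
  qed simp
  then show ?thesis by simp
qed

text \<open>A closed ball is compact, which bounds the derivative, and convex, which lets the mean
  value inequality turn that bound into a Lipschitz constant.\<close>

lemma C_on_lipschitz_cball:
  fixes f :: "'a::euclidean_space \<Rightarrow> 'b::real_normed_vector"
  assumes f: "C_on (Suc n) S f" "cball a \<rho> \<subseteq> S"
  shows "\<exists>K\<ge>0. \<forall>x\<in>cball a \<rho>. \<forall>y\<in>cball a \<rho>. norm (f x - f y) \<le> K * norm (x - y)"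
proof -
  obtain K where K: "K \<ge> 0" "\<And>x v. x \<in> cball a \<rho> \<Longrightarrow> norm (Dir f x v) \<le> K * norm v"
    using Dir_bound_compact[OF f(1) compact_cball f(2)] by blast
  have "norm (f x - f y) \<le> K * norm (x - y)" if "x \<in> cball a \<rho>" "y \<in> cball a \<rho>" for x y
  proof (rule differentiable_bound[OF convex_cball _ _ that])
    fix z assume z: "z \<in> cball a \<rho>"
    show "(f has_derivative Dir f z) (at z within cball a \<rho>)"
      using C_on_has_derivative[OF f(1)] f(2) z has_derivative_at_withinI by blast
    show "onorm (Dir f z) \<le> K" using K z by (intro onorm_bound) auto
  qed
  then show ?thesis using K by blast
qed

lemma Dir_lipschitz_cball:
  fixes f :: "'a::euclidean_space \<Rightarrow> 'b::real_normed_vector"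
  assumes f: "C_on (Suc (Suc n)) S f" "cball a \<rho> \<subseteq> S"
  shows "\<exists>K\<ge>0. \<forall>x\<in>cball a \<rho>. \<forall>y\<in>cball a \<rho>. \<forall>v. norm (Dir f x v - Dir f y v) \<le> K * norm (x - y) * norm v"
proof -
  define I where "I = cball a \<rho> \<times> cball a \<rho>"
  have "\<exists>K\<ge>0. \<forall>i\<in>I. \<forall>v. norm (Dir f (fst i) v - Dir f (snd i) v) \<le> K * norm (fst i - snd i) * norm v"
  proof (rule linear_family_bound)
    show "linear (\<lambda>v. Dir f (fst i) v - Dir f (snd i) v)" if "i \<in> I" for i
      by (intro linear_compose_sub linear_Dir[OF f(1)]) (use that f(2) in \<open>auto simp: I_def\<close>)
    show "\<exists>K\<ge>0. \<forall>i\<in>I. norm (Dir f (fst i) b - Dir f (snd i) b) \<le> K * norm (fst i - snd i)" for b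
      using C_on_lipschitz_cball[OF C_on_Dir[OF f(1)] f(2), of b] by (simp add: I_def)
  qed simp
  then show ?thesis by (simp add: I_def)
qed

text \<open>The second direction ranges over the noncompact \<open>UNIV\<close>. Its norm serves as
  the scale of the family, and \<open>Dir_bound_compact\<close> supplies the bound for each fixed
  first direction.\<close>

lemma Dir2_bound_cball:
  fixes f :: "'a::euclidean_space \<Rightarrow> 'b::real_normed_vector"
  assumes f: "C_on (Suc (Suc n)) S f" "open S" "cball a \<rho> \<subseteq> S"
  shows "\<exists>K\<ge>0. \<forall>x\<in>cball a \<rho>. \<forall>v w. norm (Dir2 f x v w) \<le> K * norm v * norm w"
proof -
  have "\<exists>K\<ge>0. \<forall>i\<in>cball a \<rho> \<times> UNIV. \<forall>v. norm (Dir2 f (fst i) v (snd i)) \<le> K * norm (snd i) * norm v"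
  proof (rule linear_family_bound)
    fix i :: "'a \<times> 'a" assume "i \<in> cball a \<rho> \<times> UNIV"
    then show "linear (\<lambda>v. Dir2 f (fst i) v (snd i))"
      using f by (intro linear_Dir2_left[OF f(1,2)]) auto
  next
    fix b :: 'a
    show "\<exists>K\<ge>0. \<forall>i\<in>cball a \<rho> \<times> UNIV. norm (Dir2 f (fst i) b (snd i)) \<le> K * norm (snd i)"
      using Dir_bound_compact[OF C_on_Dir[OF f(1)] compact_cball f(3)] by auto
  qed auto
  then obtain K where K: "K \<ge> 0" "\<And>x v w. x \<in> cball a \<rho> \<Longrightarrow> norm (Dir2 f x v w) \<le> K * norm w * norm v"
    by fastforce
  have "norm (Dir2 f x v w) \<le> K * norm v * norm w" if "x \<in> cball a \<rho>" for x v w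
    using K(2)[OF that, of v w] by (simp only: mult_ac)
  then show ?thesis using K(1) by blast
qed

lemma Dir2_lipschitz_cball:
  fixes f :: "'a::euclidean_space \<Rightarrow> 'b::real_normed_vector"
  assumes f: "C_on (Suc (Suc (Suc n))) S f" "open S" "cball a \<rho> \<subseteq> S"
  shows "\<exists>K\<ge>0. \<forall>x\<in>cball a \<rho>. \<forall>y\<in>cball a \<rho>. \<forall>v w.
    norm (Dir2 f x v w - Dir2 f y v w) \<le> K * norm (x - y) * norm v * norm w"
proof -
  define I where "I = (cball a \<rho> \<times> cball a \<rho>) \<times> (UNIV :: 'a set)"
  have "\<exists>K\<ge>0. \<forall>i\<in>I. \<forall>v. norm (Dir2 f (fst (fst i)) v (snd i) - Dir2 f (snd (fst i)) v (snd i))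
      \<le> K * (norm (fst (fst i) - snd (fst i)) * norm (snd i)) * norm v"
  proof (rule linear_family_bound)
    fix i assume "i \<in> I"
    then show "linear (\<lambda>v. Dir2 f (fst (fst i)) v (snd i) - Dir2 f (snd (fst i)) v (snd i))"
      using f by (intro linear_compose_sub linear_Dir2_left[OF f(1,2)]) (auto simp: I_def)
  next
    fix b :: 'a
    show "\<exists>K\<ge>0. \<forall>i\<in>I. norm (Dir2 f (fst (fst i)) b (snd i) - Dir2 f (snd (fst i)) b (snd i))
        \<le> K * (norm (fst (fst i) - snd (fst i)) * norm (snd i))"
      using Dir_lipschitz_cball[OF C_on_Dir[OF f(1)] f(3), of b] by (auto simp: I_def mult_ac)
  qed auto
  then obtain K where K: "K \<ge> 0" "\<And>x y v w. x \<in> cball a \<rho> \<Longrightarrow> y \<in> cball a \<rho> \<Longrightarrow>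
      norm (Dir2 f x v w - Dir2 f y v w) \<le> K * (norm (x - y) * norm w) * norm v"
    unfolding I_def by fastforce
  have "norm (Dir2 f x v w - Dir2 f y v w) \<le> K * norm (x - y) * norm v * norm w"
    if "x \<in> cball a \<rho>" "y \<in> cball a \<rho>" for x y v w
    using K(2)[OF that, of v w] by (simp only: mult_ac)
  then show ?thesis using K(1) by blast
qed

section \<open>Orthogonal projections\<close>

lemma orth_proj_unique:
  fixes S :: "'a::euclidean_space set"
  assumes "subspace S"
  shows "\<exists>!y. y \<in> S \<and> x - y \<in> orthogonal_comp S"
proof -
  obtain y z where yz: "y \<in> span S" "\<And>w. w \<in> span S \<Longrightarrow> orthogonal z w" "x = y + z"
    using orthogonal_subspace_decomp_exists[of S x] by blast
  have sp: "span S = S" using assms by simp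
  show ?thesis
  proof (rule ex1I[of _ y])
    show "y \<in> S \<and> x - y \<in> orthogonal_comp S"
      using yz sp by (simp add: orthogonal_comp_def orthogonal_commute)
  next
    fix y' assume y': "y' \<in> S \<and> x - y' \<in> orthogonal_comp S"
    have "y - y' \<in> S" using yz(1) y' sp assms by (simp add: subspace_diff)
    moreover have "w \<bullet> (y - y') = 0" if "w \<in> S" for w
    proof -
      have "w \<bullet> z = 0" "w \<bullet> (x - y') = 0"
        using yz(2) y' that sp by (auto simp: orthogonal_comp_def orthogonal_def inner_commute)
      then show ?thesis using yz(3) by (simp add: inner_diff_right inner_add_right)
    qed
    ultimately have "(y - y') \<bullet> (y - y') = 0" by blast
    then show "y' = y" by simp
  qed
qed

lemma
  assumes "subspace S"
  shows orth_proj_in: "orth_proj S x \<in> S"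
    and orth_proj_orthogonal: "y \<in> S \<Longrightarrow> (x - orth_proj S x) \<bullet> y = 0"
proof -
  have "orth_proj S x \<in> S \<and> x - orth_proj S x \<in> orthogonal_comp S"
    unfolding orth_proj_def by (rule theI'[OF orth_proj_unique[OF assms]])
  then show "orth_proj S x \<in> S" "y \<in> S \<Longrightarrow> (x - orth_proj S x) \<bullet> y = 0"
    by (auto simp: orthogonal_comp_def orthogonal_def inner_commute)
qed

lemma orth_proj_eqI:
  assumes "subspace S" "y \<in> S" "\<And>z. z \<in> S \<Longrightarrow> (x - y) \<bullet> z = 0"
  shows "orth_proj S x = y"
  unfolding orth_proj_def
  by (rule the1_equality[OF orth_proj_unique[OF assms(1)]])
     (use assms in \<open>auto simp: orthogonal_comp_def orthogonal_def inner_commute\<close>)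

lemma orth_proj_id: "subspace S \<Longrightarrow> x \<in> S \<Longrightarrow> orth_proj S x = x"
  by (rule orth_proj_eqI) auto

lemma orth_proj_inner:
  assumes "subspace S" "y \<in> S"
  shows "orth_proj S x \<bullet> y = x \<bullet> y"
  using orth_proj_orthogonal[OF assms, of x] by (simp add: inner_diff_left)

lemma orth_proj_eq_0: "subspace S \<Longrightarrow> (\<And>z. z \<in> S \<Longrightarrow> x \<bullet> z = 0) \<Longrightarrow> orth_proj S x = 0"
  by (rule orth_proj_eqI) (auto simp: subspace_0)

lemma linear_orth_proj:
  assumes "subspace S" shows "linear (orth_proj S)"
proof
  fix x y :: 'a and r :: real
  show "orth_proj S (x + y) = orth_proj S x + orth_proj S y"
    by (rule orth_proj_eqI[OF assms])
       (simp_all add: assms subspace_add orth_proj_in inner_add_left inner_diff_left orth_proj_inner)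
  show "orth_proj S (r *\<^sub>R x) = r *\<^sub>R orth_proj S x"
    by (rule orth_proj_eqI[OF assms])
       (simp_all add: assms subspace_scale orth_proj_in inner_diff_left orth_proj_inner)
qed

lemma norm_orth_proj_le:
  assumes "subspace S" shows "norm (orth_proj S x) \<le> norm x"
proof -
  have "(norm (orth_proj S x))\<^sup>2 = x \<bullet> orth_proj S x"
    using orth_proj_inner[OF assms orth_proj_in[OF assms]] by (simp add: power2_norm_eq_inner)
  also have "\<dots> \<le> norm x * norm (orth_proj S x)" by (rule norm_cauchy_schwarz)
  finally have "norm (orth_proj S x) * norm (orth_proj S x) \<le> norm x * norm (orth_proj S x)"
    by (simp only: power2_eq_square)
  then show ?thesis by (metis mult_right_le_imp_le norm_ge_zero order_le_less)
qed

lemma bounded_linear_orth_proj: "subspace S \<Longrightarrow> bounded_linear (orth_proj S)"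
  using linear_orth_proj linear_conv_bounded_linear by blast

lemma orth_proj_orthogonal_comp:
  assumes "subspace S"
  shows "orth_proj (orthogonal_comp S) x = x - orth_proj S x"
proof (rule orth_proj_eqI)
  show "subspace (orthogonal_comp S)" by (rule subspace_orthogonal_comp)
  show "x - orth_proj S x \<in> orthogonal_comp S"
    using orth_proj_orthogonal[OF assms, of _ x] by (auto simp: orthogonal_comp_def orthogonal_def inner_commute)
  show "(x - (x - orth_proj S x)) \<bullet> z = 0" if "z \<in> orthogonal_comp S" for z
    using that orth_proj_in[OF assms] by (auto simp: orthogonal_comp_def orthogonal_def)
qed

section \<open>The Picard-Lindeloef theorem\<close>

text \<open>Picard iteration is a contraction of the space of bounded continuous functions on the
  real line. Clipping the time to \<open>{-\<epsilon>..\<epsilon>}\<close> makes every iterate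
  bounded, and the fixed point solves the equation on the open interval.\<close>

lemma picard_lindelof_global:
  fixes F :: "'a::euclidean_space \<Rightarrow> 'a"
  assumes K: "0 \<le> K" and F: "\<And>x y. norm (F x - F y) \<le> K * norm (x - y)"
  shows "\<exists>\<epsilon>>0. \<exists>x. x 0 = x0 \<and> (\<forall>s\<in>{-\<epsilon><..<\<epsilon>}. (x has_vector_derivative F (x s)) (at s))"
proof -
  \<comment> \<open>Two integrals over intervals of length at most \<open>2 * \<epsilon>\<close>
    give the contraction factor \<open>4 * \<epsilon> * K = K / (K + 1)\<close>; the 1 added to
    \<open>K\<close> keeps it below 1.\<close>
  define \<epsilon> where "\<epsilon> = inverse (K + 1) / 4"
  define clip where "clip s = max (-\<epsilon>) (min \<epsilon> s)" for s :: real
  have \<epsilon>4: "4 * \<epsilon> = inverse (K + 1)" by (simp add: \<epsilon>_def)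
  have \<epsilon>: "0 < \<epsilon>" using K by (simp add: \<epsilon>_def)
  have clip: "clip s \<in> {-\<epsilon>..\<epsilon>}" for s using \<epsilon> by (auto simp: clip_def)
  have clip_id: "clip s = s" if "s \<in> {-\<epsilon>..\<epsilon>}" for s using that by (auto simp: clip_def)
  have "K-lipschitz_on UNIV F"
    using K F by (auto simp: lipschitz_on_def dist_norm)
  then have contF: "continuous_on UNIV F" by (rule lipschitz_on_continuous_on)
  have cont: "continuous_on S (\<lambda>r. F (apply_bcontfun x r))" for x :: "real \<Rightarrow>\<^sub>C 'a" and S
    by (rule continuous_on_compose2[OF contF]) auto
  \<comment> \<open>Subtracting integrals with the common lower end \<open>-\<epsilon>\<close> gives
    the integral from 0 to \<open>clip s\<close> for either sign of \<open>s\<close>.\<close>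
  define g where "g x s = x0 + integral {-\<epsilon>..clip s} (\<lambda>r. F (apply_bcontfun x r))
      - integral {-\<epsilon>..0} (\<lambda>r. F (apply_bcontfun x r))" for x :: "real \<Rightarrow>\<^sub>C 'a" and s
  have contg: "continuous_on UNIV (g x)" for x
  proof -
    have "continuous_on {-\<epsilon>..\<epsilon>} (\<lambda>u. integral {-\<epsilon>..u} (\<lambda>r. F (apply_bcontfun x r)))"
      by (intro indefinite_integral_continuous_1 integrable_continuous_real cont)
    moreover have "continuous_on UNIV clip" unfolding clip_def by (intro continuous_intros)
    ultimately have "continuous_on UNIV (\<lambda>s. integral {-\<epsilon>..clip s} (\<lambda>r. F (apply_bcontfun x r)))"
      by (rule continuous_on_compose2) (use clip in auto)
    then show ?thesis unfolding g_def by (intro continuous_intros)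
  qed
  have "g x \<in> bcontfun" for x
  proof -
    have "range (g x) \<subseteq> g x ` {-\<epsilon>..\<epsilon>}"
    proof
      fix y assume "y \<in> range (g x)"
      then obtain s where "y = g x s" by blast
      then have "y = g x (clip s)" unfolding g_def clip_id[OF clip] .
      then show "y \<in> g x ` {-\<epsilon>..\<epsilon>}" using clip by blast
    qed
    moreover have "compact (g x ` {-\<epsilon>..\<epsilon>})"
      by (rule compact_continuous_image[OF continuous_on_subset[OF contg]]) auto
    ultimately have "bounded (range (g x))" using bounded_subset compact_imp_bounded by blast
    then show ?thesis using contg by (simp add: bcontfun_def)
  qed
  then have app: "apply_bcontfun (Bcontfun (g x)) = g x" for x by (simp add: Bcontfun_inverse)
  define T where "T x = Bcontfun (g x)" for x
  have "dist (T x) (T y) \<le> (K / (K + 1)) * dist x y" for x y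
  proof (rule dist_bound)
    fix s
    have bd: "norm (integral {-\<epsilon>..u} (\<lambda>r. F (apply_bcontfun x r)) - integral {-\<epsilon>..u} (\<lambda>r. F (apply_bcontfun y r)))
        \<le> K * dist x y * (2 * \<epsilon>)" if "u \<in> {-\<epsilon>..\<epsilon>}" for u
    proof -
      have "integral {-\<epsilon>..u} (\<lambda>r. F (apply_bcontfun x r)) - integral {-\<epsilon>..u} (\<lambda>r. F (apply_bcontfun y r))
         = integral {-\<epsilon>..u} (\<lambda>r. F (apply_bcontfun x r) - F (apply_bcontfun y r))"
        by (rule integral_diff[symmetric]) (intro integrable_continuous_real cont)+
      also have "norm \<dots> \<le> K * dist x y * (u - (-\<epsilon>))"
      proof (rule integral_bound)
        show "continuous_on {-\<epsilon>..u} (\<lambda>r. F (apply_bcontfun x r) - F (apply_bcontfun y r))"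
          by (intro continuous_on_diff cont)
        show "norm (F (apply_bcontfun x r) - F (apply_bcontfun y r)) \<le> K * dist x y" for r
          using F[of "apply_bcontfun x r" "apply_bcontfun y r"] dist_bounded[of x r y] K
          by (metis dist_norm mult_left_mono order_trans)
      qed (use that in auto)
      also have "\<dots> \<le> K * dist x y * (2 * \<epsilon>)"
        using that K by (intro mult_left_mono) auto
      finally show ?thesis .
    qed
    have "dist (g x s) (g y s) \<le> K * dist x y * (2 * \<epsilon>) + K * dist x y * (2 * \<epsilon>)"
    proof -
      have tri: "norm ((x0 + a - b) - (x0 + a' - b')) \<le> e + e"
        if "norm (a - a') \<le> e" "norm (b - b') \<le> e" for a a' b b' :: 'a and e
        using norm_triangle_ineq4[of "a - a'" "b - b'"] that by (simp add: algebra_simps)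
      show ?thesis
        unfolding g_def dist_norm[of "_ - _"] by (rule tri[OF bd[OF clip] bd]) (use \<epsilon> in simp)
    qed
    also have "\<dots> = (4 * \<epsilon>) * (K * dist x y)" by (simp add: algebra_simps)
    also have "\<dots> = (K / (K + 1)) * dist x y" unfolding \<epsilon>4 divide_inverse by (simp only: mult_ac)
    finally show "dist (apply_bcontfun (T x) s) (apply_bcontfun (T y) s) \<le> (K / (K + 1)) * dist x y"
      by (simp add: T_def app)
  qed
  moreover have "0 \<le> K / (K + 1)" "K / (K + 1) < 1" using K by auto
  ultimately obtain x where x: "T x = x" using banach_fix_type[of "K / (K + 1)" T] by blast
  have xg: "apply_bcontfun x s = g x s" for s using x app[of x] by (metis T_def)
  have xg: "apply_bcontfun x s = x0 + integral {-\<epsilon>..s} (\<lambda>r. F (apply_bcontfun x r))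
      - integral {-\<epsilon>..0} (\<lambda>r. F (apply_bcontfun x r))" if "s \<in> {-\<epsilon>..\<epsilon>}" for s
    using xg[of s] unfolding g_def clip_id[OF that] .
  have "(apply_bcontfun x has_vector_derivative F (apply_bcontfun x s)) (at s)" if s: "s \<in> {-\<epsilon><..<\<epsilon>}" for s
  proof -
    have "((\<lambda>u. integral {-\<epsilon>..u} (\<lambda>r. F (apply_bcontfun x r))) has_vector_derivative F (apply_bcontfun x s))
        (at s within {-\<epsilon>..\<epsilon>})"
      using s by (intro integral_has_vector_derivative[OF cont]) auto
    then have "((\<lambda>u. integral {-\<epsilon>..u} (\<lambda>r. F (apply_bcontfun x r))) has_vector_derivative F (apply_bcontfun x s)) (at s)"
      using s by (simp add: at_within_Icc_at)
    then have "((\<lambda>u. x0 + integral {-\<epsilon>..u} (\<lambda>r. F (apply_bcontfun x r))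
       - integral {-\<epsilon>..0} (\<lambda>r. F (apply_bcontfun x r))) has_vector_derivative F (apply_bcontfun x s)) (at s)"
      by (auto intro!: derivative_eq_intros)
    then show ?thesis
      by (rule has_vector_derivative_transform_within_open[where S="{-\<epsilon><..<\<epsilon>}"])
         (use s in \<open>auto intro!: xg[symmetric]\<close>)
  qed
  moreover have "apply_bcontfun x 0 = x0" using xg[of 0] \<epsilon> by simp
  ultimately show ?thesis using \<epsilon> by blast
qed

text \<open>Precomposing \<open>F\<close> with the projection onto the ball, which is 1-Lipschitz,
  gives a globally Lipschitz field. Its solution starts at the centre and stays in the ball for a
  short time, where both fields agree.\<close>

lemma picard_lindelof:
  fixes F :: "'a::euclidean_space \<Rightarrow> 'a"
  assumes K: "0 \<le> K" and \<rho>: "0 < \<rho>"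
    and F: "\<And>x y. x \<in> cball x0 \<rho> \<Longrightarrow> y \<in> cball x0 \<rho> \<Longrightarrow> norm (F x - F y) \<le> K * norm (x - y)"
  shows "\<exists>\<epsilon>>0. \<exists>x. x 0 = x0 \<and>
    (\<forall>s\<in>{-\<epsilon><..<\<epsilon>}. x s \<in> cball x0 \<rho> \<and> (x has_vector_derivative F (x s)) (at s))"
proof -
  let ?c = "closest_point (cball x0 \<rho>)"
  have ne: "closed (cball x0 \<rho>)" "cball x0 \<rho> \<noteq> {}" "convex (cball x0 \<rho>)" using \<rho> by auto
  have "norm (F (?c x) - F (?c y)) \<le> K * norm (x - y)" for x y
    using F[OF closest_point_in_set[OF ne(1,2)] closest_point_in_set[OF ne(1,2)], of x y]
      mult_left_mono[OF closest_point_lipschitz[OF ne(3,1,2), of x y] K]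
    by (simp add: dist_norm)
  from picard_lindelof_global[OF K this] obtain \<epsilon> x where
    x: "\<epsilon> > 0" "x 0 = x0" "\<And>s. s \<in> {-\<epsilon><..<\<epsilon>} \<Longrightarrow> (x has_vector_derivative F (?c (x s))) (at s)" by blast
  have "isCont x 0" using x(1) x(3)[of 0] by (intro has_vector_derivative_continuous) auto
  then obtain \<delta> where \<delta>: "\<delta> > 0" "\<And>s. dist s 0 < \<delta> \<Longrightarrow> dist (x s) (x 0) < \<rho>"
    using \<rho> unfolding continuous_at_eps_delta by blast
  have "x s \<in> cball x0 \<rho> \<and> (x has_vector_derivative F (x s)) (at s)" if "s \<in> {-min \<epsilon> \<delta><..<min \<epsilon> \<delta>}" for s
  proof -
    have "\<bar>s\<bar> < min \<epsilon> \<delta>" using that unfolding greaterThanLessThan_iff by linarith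
    then have *: "x s \<in> cball x0 \<rho>" using \<delta>(2)[of s] x(2) by (simp add: dist_commute)
    moreover have "s \<in> {-\<epsilon><..<\<epsilon>}" using \<open>\<bar>s\<bar> < min \<epsilon> \<delta>\<close> by auto
    ultimately show ?thesis using x(3)[of s] by (simp add: closest_point_self[OF *])
  qed
  then show ?thesis using x \<delta> by (intro exI[of _ "min \<epsilon> \<delta>"]) auto
qed

section \<open>Slice charts\<close>

lemma has_vector_derivative_frechet:
  assumes "(f has_derivative f') (at (c s))" "(c has_vector_derivative c') (at s)"
  shows "((\<lambda>s. f (c s)) has_vector_derivative f' c') (at s)"
  using vector_derivative_diff_chain_within[of c c' s UNIV f f'] assms
  by (auto simp: o_def intro: has_derivative_at_withinI)

lemma has_vector_derivative_Dir:
  fixes f :: "'a::euclidean_space \<Rightarrow> 'b::real_normed_vector"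
  assumes f: "C_on (Suc (Suc n)) S f" "open S" "c s \<in> S"
    and c: "(c has_vector_derivative c') (at s)" and e: "(e has_vector_derivative e') (at s)"
  shows "((\<lambda>s. Dir f (c s) (e s)) has_vector_derivative Dir2 f (c s) (e s) c' + Dir f (c s) e') (at s)"
  using has_derivative_Dir[OF f c[unfolded has_vector_derivative_def] e[unfolded has_vector_derivative_def]]
  by (simp add: has_vector_derivative_def linear_cmul[OF linear_Dir2_right[OF f(1,3)]]
      linear_cmul[OF linear_Dir[OF f(1,3)]] scaleR_add_right)

text \<open>The projection onto \<open>L\<close> is linear and fixes \<open>f\<close> near
  \<open>s\<close>, so it fixes the derivative as well. This keeps velocities read in a chart inside
  \<open>L\<close>.\<close>

lemma has_vector_derivative_in_subspace:
  fixes f :: "real \<Rightarrow> 'a::euclidean_space"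
  assumes L: "subspace L" and J: "open J" "s \<in> J" "\<And>r. r \<in> J \<Longrightarrow> f r \<in> L"
    and f: "(f has_vector_derivative f') (at s)"
  shows "f' \<in> L"
proof -
  have "((\<lambda>r. orth_proj L (f r)) has_vector_derivative orth_proj L f') (at s)"
    by (rule has_vector_derivative_frechet[OF bounded_linear_imp_has_derivative[OF bounded_linear_orth_proj[OF L]] f])
  then have "(f has_vector_derivative orth_proj L f') (at s)"
    by (rule has_vector_derivative_transform_within_open[OF _ J(1,2)]) (simp add: orth_proj_id[OF L] J(3))
  then show ?thesis
    using vector_derivative_unique_at[OF f] orth_proj_in[OF L, of f'] by metis
qed

locale slice_chart =
  fixes M U W L :: "'a::euclidean_space set" and \<phi> \<psi> :: "'a \<Rightarrow> 'a"
  assumes open_U: "open U" and open_W: "open W" and homeo: "homeomorphism U W \<phi> \<psi>"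
    and smooth_\<phi>: "smooth_on U \<phi>" and smooth_\<psi>: "smooth_on W \<psi>"
    and L: "subspace L" and slice: "\<phi> ` (M \<inter> U) = L \<inter> W"
begin

lemma C_\<phi>: "C_on n U \<phi>" and C_\<psi>: "C_on n W \<psi>"
  using smooth_\<phi> smooth_\<psi> unfolding smooth_on_def by blast+

lemma \<phi>_in: "x \<in> U \<Longrightarrow> \<phi> x \<in> W" and \<psi>_in: "c \<in> W \<Longrightarrow> \<psi> c \<in> U"
  and \<psi>_\<phi>: "x \<in> U \<Longrightarrow> \<psi> (\<phi> x) = x" and \<phi>_\<psi>: "c \<in> W \<Longrightarrow> \<phi> (\<psi> c) = c"
  using homeo by (auto simp: homeomorphism_def)

lemma \<phi>_slice: "p \<in> M \<Longrightarrow> p \<in> U \<Longrightarrow> \<phi> p \<in> L"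
  using slice by blast

lemma \<psi>_slice:
  assumes "c \<in> L" "c \<in> W" shows "\<psi> c \<in> M"
proof -
  have "c \<in> \<phi> ` (M \<inter> U)" using assms slice by blast
  then show ?thesis using \<psi>_\<phi> by auto
qed

lemma has_derivative_\<phi>: "x \<in> U \<Longrightarrow> (\<phi> has_derivative Dir \<phi> x) (at x)"
  and has_derivative_\<psi>: "c \<in> W \<Longrightarrow> (\<psi> has_derivative Dir \<psi> c) (at c)"
  by (rule C_on_has_derivative[OF C_\<phi>], assumption) (rule C_on_has_derivative[OF C_\<psi>])

lemma linear_D\<phi>: "x \<in> U \<Longrightarrow> linear (Dir \<phi> x)" and linear_D\<psi>: "c \<in> W \<Longrightarrow> linear (Dir \<psi> c)"
  by (rule linear_Dir[OF C_\<phi>], assumption) (rule linear_Dir[OF C_\<psi>])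

lemma D\<phi>_D\<psi>:
  assumes "c \<in> W" shows "Dir \<phi> (\<psi> c) (Dir \<psi> c v) = v"
proof -
  have "((\<lambda>x. \<phi> (\<psi> x)) has_derivative (\<lambda>v. Dir \<phi> (\<psi> c) (Dir \<psi> c v))) (at c)"
    by (rule has_derivative_compose[OF has_derivative_\<psi>[OF assms] has_derivative_\<phi>[OF \<psi>_in[OF assms]]])
  moreover have "((\<lambda>x. \<phi> (\<psi> x)) has_derivative (\<lambda>v. v)) (at c)"
    by (rule has_derivative_transform_within_open[OF has_derivative_ident open_W assms]) (simp add: \<phi>_\<psi>)
  ultimately show ?thesis using has_derivative_unique by metis
qed

lemma D\<psi>_D\<phi>:
  assumes "x \<in> U" shows "Dir \<psi> (\<phi> x) (Dir \<phi> x v) = v"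
proof -
  have "((\<lambda>x. \<psi> (\<phi> x)) has_derivative (\<lambda>v. Dir \<psi> (\<phi> x) (Dir \<phi> x v))) (at x)"
    by (rule has_derivative_compose[OF has_derivative_\<phi>[OF assms] has_derivative_\<psi>[OF \<phi>_in[OF assms]]])
  moreover have "((\<lambda>x. \<psi> (\<phi> x)) has_derivative (\<lambda>v. v)) (at x)"
    by (rule has_derivative_transform_within_open[OF has_derivative_ident open_U assms]) (simp add: \<psi>_\<phi>)
  ultimately show ?thesis using has_derivative_unique by metis
qed

text \<open>A curve in \<open>M\<close> read through \<open>\<phi>\<close> runs in \<open>L\<close>,
  so its velocity lies in \<open>L\<close>; conversely \<open>\<psi>\<close> carries a straight
  segment in \<open>L\<close> to a curve in \<open>M\<close>. This turns a set of velocities of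
  curves into a visible subspace.\<close>

lemma tangent_space_eq:
  assumes p: "p \<in> M" "p \<in> U"
  shows "tangent_space_at M p = Dir \<psi> (\<phi> p) ` L"
proof (intro equalityI subsetI)
  fix t assume "t \<in> tangent_space_at M p"
  then obtain \<epsilon> \<gamma> where \<epsilon>: "\<epsilon> > 0" and sm: "smooth_on {-\<epsilon><..<\<epsilon>} \<gamma>"
    and \<gamma>: "\<gamma> ` {-\<epsilon><..<\<epsilon>} \<subseteq> M" "\<gamma> 0 = p" "(\<gamma> has_vector_derivative t) (at 0)"
    unfolding tangent_space_at_def by blast
  have cont: "continuous_on {-\<epsilon><..<\<epsilon>} \<gamma>"
    using sm C_on_imp_continuous_on unfolding smooth_on_def by blast
  define J where "J = {-\<epsilon><..<\<epsilon>} \<inter> \<gamma> -` U"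
  have J: "open J" unfolding J_def by (rule continuous_open_preimage[OF cont _ open_U]) simp
  have d: "((\<lambda>s. \<phi> (\<gamma> s)) has_vector_derivative Dir \<phi> p t) (at 0)"
    using has_vector_derivative_frechet[of \<phi> "Dir \<phi> p" \<gamma> 0, OF _ \<gamma>(3)] has_derivative_\<phi>[OF p(2)] \<gamma>(2) by simp
  have "Dir \<phi> p t \<in> L"
  proof (rule has_vector_derivative_in_subspace[OF L J _ _ d])
    show "0 \<in> J" using \<epsilon> \<gamma> p by (simp add: J_def)
    show "\<phi> (\<gamma> r) \<in> L" if "r \<in> J" for r
      using that \<gamma>(1) by (intro \<phi>_slice) (auto simp: J_def)
  qed
  then show "t \<in> Dir \<psi> (\<phi> p) ` L" using D\<psi>_D\<phi>[OF p(2), of t] by (metis imageI)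
next
  fix t assume "t \<in> Dir \<psi> (\<phi> p) ` L"
  then obtain l where l: "l \<in> L" "t = Dir \<psi> (\<phi> p) l" by blast
  have "open ((\<lambda>s. \<phi> p + s *\<^sub>R l) -` W)"
    by (rule open_vimage[OF open_W]) (intro continuous_intros)
  moreover have "0 \<in> (\<lambda>s. \<phi> p + s *\<^sub>R l) -` W" using \<phi>_in[OF p(2)] by simp
  ultimately obtain \<epsilon> where \<epsilon>: "\<epsilon> > 0" "ball 0 \<epsilon> \<subseteq> (\<lambda>s. \<phi> p + s *\<^sub>R l) -` W"
    using openE by blast
  have inW: "\<phi> p + s *\<^sub>R l \<in> W" if "s \<in> {-\<epsilon><..<\<epsilon>}" for s
    using \<epsilon>(2) that by (auto simp: subset_iff)
  have inL: "\<phi> p + s *\<^sub>R l \<in> L" for s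
    using \<phi>_slice[OF p] l L by (simp add: subspace_add subspace_scale)
  have line: "((\<lambda>s. \<phi> p + s *\<^sub>R l) has_vector_derivative l) (at 0)"
    by (auto intro!: derivative_eq_intros)
  show "t \<in> tangent_space_at M p"
    unfolding tangent_space_at_def mem_Collect_eq
  proof (intro exI conjI)
    show "\<epsilon> > 0" by fact
    show "smooth_on {-\<epsilon><..<\<epsilon>} (\<lambda>s. \<psi> (\<phi> p + s *\<^sub>R l))"
      unfolding smooth_on_def
      using C_on_scaleR_line[OF C_\<psi> open_greaterThanLessThan inW, of "-\<epsilon>" \<epsilon> _ 1] by simp
    show "(\<lambda>s. \<psi> (\<phi> p + s *\<^sub>R l)) ` {-\<epsilon><..<\<epsilon>} \<subseteq> M"
      using \<psi>_slice[OF inL inW] by blast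
    show "\<psi> (\<phi> p + 0 *\<^sub>R l) = p" using \<psi>_\<phi>[OF p(2)] by simp
    show "((\<lambda>s. \<psi> (\<phi> p + s *\<^sub>R l)) has_vector_derivative t) (at 0)"
      using has_vector_derivative_frechet[OF _ line, of \<psi>] has_derivative_\<psi>[OF \<phi>_in[OF p(2)]] l(2) by simp
  qed
qed

lemma tangent_space_\<psi>: "c \<in> L \<Longrightarrow> c \<in> W \<Longrightarrow> tangent_space_at M (\<psi> c) = Dir \<psi> c ` L"
  using tangent_space_eq[of "\<psi> c"] by (simp add: \<psi>_slice \<psi>_in \<phi>_\<psi>)

lemma subspace_tangent_image: "c \<in> W \<Longrightarrow> subspace (Dir \<psi> c ` L)"
  by (rule linear_subspace_image[OF linear_D\<psi> L])

lemma subspace_tangent: "p \<in> M \<Longrightarrow> p \<in> U \<Longrightarrow> subspace (tangent_space_at M p)"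
  by (simp add: tangent_space_eq subspace_tangent_image \<phi>_in)

lemma D\<phi>_tangent: "p \<in> M \<Longrightarrow> p \<in> U \<Longrightarrow> t \<in> tangent_space_at M p \<Longrightarrow> Dir \<phi> p t \<in> L"
  using D\<phi>_D\<psi>[OF \<phi>_in, of p] by (auto simp: tangent_space_eq \<psi>_\<phi>)

text \<open>The negative of the Christoffel symbols: \<open>Dir2 \<psi> c e b + Dir \<psi> c (\<Gamma> c b e)\<close> is the normal part
  of \<open>Dir2 \<psi> c e b\<close>.\<close>

definition \<Gamma> :: "'a \<Rightarrow> 'a \<Rightarrow> 'a \<Rightarrow> 'a" where
  "\<Gamma> c b e = - Dir \<phi> (\<psi> c) (orth_proj (Dir \<psi> c ` L) (Dir2 \<psi> c e b))"

lemma D\<psi>_\<Gamma>: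
  assumes c: "c \<in> W"
  shows "Dir \<psi> c (\<Gamma> c b e) = - orth_proj (Dir \<psi> c ` L) (Dir2 \<psi> c e b)"
  using D\<psi>_D\<phi>[OF \<psi>_in[OF c]] by (simp add: \<Gamma>_def \<phi>_\<psi>[OF c] linear_neg[OF linear_D\<psi>[OF c]])

lemma \<Gamma>_in:
  assumes c: "c \<in> W" shows "\<Gamma> c b e \<in> L"
proof -
  obtain l where l: "l \<in> L" "orth_proj (Dir \<psi> c ` L) (Dir2 \<psi> c e b) = Dir \<psi> c l"
    using orth_proj_in[OF subspace_tangent_image[OF c], of "Dir2 \<psi> c e b"] by (rule imageE)
  have "\<Gamma> c b e = - l" unfolding \<Gamma>_def l(2) D\<phi>_D\<psi>[OF c] ..
  then show ?thesis using subspace_neg[OF L l(1)] by simp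
qed

text \<open>The projection in \<open>\<Gamma>\<close> is onto a subspace moving with
  \<open>c\<close>, and the estimate is of energy type: the difference of the two values is pushed
  forward by \<open>Dir \<psi> c\<close> and paired with itself. Orthogonality of each normal part
  to its own tangent space removes every term that is not small with the differences. The bound
  \<open>R\<close> is there because a bilinear map is Lipschitz only on bounded sets.\<close>

lemma \<Gamma>_lipschitz:
  assumes cb: "cball c0 \<rho> \<subseteq> W" and R: "0 \<le> R"
  shows "\<exists>K\<ge>0. \<forall>c\<in>cball c0 \<rho>. \<forall>c'\<in>cball c0 \<rho>. \<forall>b b' e e'.
    norm b \<le> R \<longrightarrow> norm b' \<le> R \<longrightarrow> norm e \<le> R \<longrightarrow> norm e' \<le> R \<longrightarrow>
    norm (\<Gamma> c b e - \<Gamma> c' b' e') \<le> K * (norm (c - c') + norm (b - b') + norm (e - e'))"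
proof -
  obtain A1 where A1: "A1 \<ge> 0" "\<And>c c' v. c \<in> cball c0 \<rho> \<Longrightarrow> c' \<in> cball c0 \<rho> \<Longrightarrow>
      norm (Dir \<psi> c v - Dir \<psi> c' v) \<le> A1 * norm (c - c') * norm v"
    using Dir_lipschitz_cball[OF C_\<psi> cb] by blast
  obtain A2 where A2: "A2 \<ge> 0" "\<And>c v w. c \<in> cball c0 \<rho> \<Longrightarrow> norm (Dir2 \<psi> c v w) \<le> A2 * norm v * norm w"
    using Dir2_bound_cball[OF C_\<psi> open_W cb] by blast
  obtain A3 where A3: "A3 \<ge> 0" "\<And>c c' v w. c \<in> cball c0 \<rho> \<Longrightarrow> c' \<in> cball c0 \<rho> \<Longrightarrow>
      norm (Dir2 \<psi> c v w - Dir2 \<psi> c' v w) \<le> A3 * norm (c - c') * norm v * norm w"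
    using Dir2_lipschitz_cball[OF C_\<psi> open_W cb] by blast
  have cpt: "compact (\<psi> ` cball c0 \<rho>)"
    by (rule compact_continuous_image[OF continuous_on_subset[OF C_on_imp_continuous_on[OF C_\<psi>[of 0]] cb]]) simp
  have img: "\<psi> ` cball c0 \<rho> \<subseteq> U" using cb \<psi>_in by blast
  obtain a where a: "a \<ge> 0" "\<And>x v. x \<in> \<psi> ` cball c0 \<rho> \<Longrightarrow> norm (Dir \<phi> x v) \<le> a * norm v"
    using Dir_bound_compact[OF C_\<phi> cpt img] by blast
  \<comment> \<open>Coercivity: \<open>Dir \<phi> (\<psi> c)\<close> is a left inverse of
    \<open>Dir \<psi> c\<close>, bounded uniformly over the compact image of the ball.\<close>
  have low: "norm v \<le> a * norm (Dir \<psi> c v)" if "c \<in> cball c0 \<rho>" for c v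
    using a(2)[of "\<psi> c" "Dir \<psi> c v"] that cb D\<phi>_D\<psi>[of c v] by auto
  define B where "B = A2 * R * R"
  have B: "B \<ge> 0" using A2(1) R by (simp add: B_def)
  have D2: "norm (Dir2 \<psi> c e b) \<le> B" if "c \<in> cball c0 \<rho>" "norm b \<le> R" "norm e \<le> R" for c b e
  proof -
    have "norm (Dir2 \<psi> c e b) \<le> A2 * norm e * norm b" by (rule A2(2)[OF that(1)])
    also have "\<dots> \<le> A2 * R * R" using that A2(1) R by (intro mult_mono) auto
    finally show ?thesis by (simp add: B_def)
  qed
  define C where "C = A3 * R * R + A2 * R + A2 * R"
  have C: "C \<ge> 0" using A2(1) A3(1) R by (simp add: C_def)
  define K where "K = a * (A1 * a * B + C + A1 * a * B)"
  have "norm (\<Gamma> c b e - \<Gamma> c' b' e') \<le> K * (norm (c - c') + norm (b - b') + norm (e - e'))"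
    if c: "c \<in> cball c0 \<rho>" "c' \<in> cball c0 \<rho>"
      and R: "norm b \<le> R" "norm b' \<le> R" "norm e \<le> R" "norm e' \<le> R" for c c' b b' e e'
  proof -
    have cW: "c \<in> W" "c' \<in> W" using c cb by auto
    define \<delta> where "\<delta> = norm (c - c') + norm (b - b') + norm (e - e')"
    define r where "r = \<Gamma> c b e"
    define r' where "r' = \<Gamma> c' b' e'"
    define Q where "Q = Dir2 \<psi> c e b"
    define Q' where "Q' = Dir2 \<psi> c' e' b'"
    \<comment> \<open>\<open>N\<close> and \<open>N'\<close> are the normal parts of the two second
      derivatives; \<open>r\<close> and \<open>r'\<close> are the chart coordinates of the
      tangential corrections.\<close>
    define N where "N = Q + Dir \<psi> c r"
    define N' where "N' = Q' + Dir \<psi> c' r'"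
    have \<delta>: "norm (c - c') \<le> \<delta>" "norm (b - b') \<le> \<delta>" "norm (e - e') \<le> \<delta>" "0 \<le> \<delta>" by (auto simp: \<delta>_def)
    have rL: "r \<in> L" "r' \<in> L" using \<Gamma>_in cW by (auto simp: r_def r'_def)
    have N_eq: "N = Q - orth_proj (Dir \<psi> c ` L) Q" "N' = Q' - orth_proj (Dir \<psi> c' ` L) Q'"
      using D\<psi>_\<Gamma>[OF cW(1)] D\<psi>_\<Gamma>[OF cW(2)] by (auto simp: N_def N'_def Q_def Q'_def r_def r'_def)
    have N0: "N \<bullet> Dir \<psi> c l = 0" "N' \<bullet> Dir \<psi> c' l = 0" if "l \<in> L" for l
      unfolding N_eq using that cW by (auto intro!: orth_proj_orthogonal subspace_tangent_image)
    have Q': "norm Q' \<le> B" unfolding Q'_def using D2[OF c(2)] R by auto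
    have "norm N' \<le> norm Q'"
      using norm_orth_proj_le[OF subspace_orthogonal_comp, of "Dir \<psi> c' ` L" Q']
        orth_proj_orthogonal_comp[OF subspace_tangent_image[OF cW(2)], of Q'] by (simp add: N_eq)
    then have N': "norm N' \<le> B" using Q' by linarith
    have "norm r' \<le> a * norm (Dir \<psi> c' r')" by (rule low[OF c(2)])
    also have "\<dots> \<le> a * B"
      using norm_orth_proj_le[OF subspace_tangent_image[OF cW(2)], of Q'] Q' a(1)
      by (intro mult_left_mono) (auto simp: r'_def D\<psi>_\<Gamma>[OF cW(2)] Q'_def)
    finally have r': "norm r' \<le> a * B" .
    have Qd: "norm (Q' - Q) \<le> C * \<delta>"
    proof -
      have "Q - Q' = (Dir2 \<psi> c e b - Dir2 \<psi> c' e b) + Dir2 \<psi> c' (e - e') b + Dir2 \<psi> c' e' (b - b')"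
        unfolding Q_def Q'_def
        by (simp add: linear_diff[OF linear_Dir2_left[OF C_\<psi> open_W cW(2)]]
            linear_diff[OF linear_Dir2_right[OF C_\<psi> cW(2)]])
      also have "norm \<dots> \<le> A3 * norm (c - c') * norm e * norm b + A2 * norm (e - e') * norm b
          + A2 * norm e' * norm (b - b')"
        by (intro norm_triangle_mono A3(2) A2(2) c)
      also have "\<dots> \<le> A3 * \<delta> * R * R + A2 * \<delta> * R + A2 * R * \<delta>"
        using A3(1) A2(1) \<delta> R \<open>0 \<le> R\<close> by (intro add_mono mult_mono) auto
      also have "\<dots> = C * \<delta>" by (simp add: C_def algebra_simps)
      finally show ?thesis by (simp add: norm_minus_commute)
    qed
    define h where "h = r - r'"
    have hL: "h \<in> L" using rL L by (simp add: h_def subspace_diff)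
    have lin: "Dir \<psi> c h = Dir \<psi> c r - Dir \<psi> c r'"
      unfolding h_def by (rule linear_diff[OF linear_D\<psi>[OF cW(1)]])
    let ?x = "Dir \<psi> c h"
    have dec: "?x = N - N' + (Q' - Q) - (Dir \<psi> c r' - Dir \<psi> c' r')"
      by (simp add: lin N_def N'_def)
    have xN: "?x \<bullet> N = 0" "Dir \<psi> c' h \<bullet> N' = 0"
      using N0[OF hL] by (metis inner_commute)+
    have "?x \<bullet> ?x = ?x \<bullet> N - ?x \<bullet> N' + ?x \<bullet> (Q' - Q) - ?x \<bullet> (Dir \<psi> c r' - Dir \<psi> c' r')"
      by (subst (2) dec) (simp add: inner_diff_right inner_add_right)
    \<comment> \<open>\<open>N'\<close> is orthogonal to the tangent space at the other point, so
      \<open>?x\<close> may be replaced by \<open>?x - Dir \<psi> c' h\<close>, which is small with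
      \<open>c - c'\<close>.\<close>
    also have "\<dots> = - ((?x - Dir \<psi> c' h) \<bullet> N') + ?x \<bullet> (Q' - Q) - ?x \<bullet> (Dir \<psi> c r' - Dir \<psi> c' r')"
      using xN by (simp add: inner_diff_left)
    also have "\<dots> \<le> norm (?x - Dir \<psi> c' h) * norm N' + norm ?x * norm (Q' - Q)
        + norm ?x * norm (Dir \<psi> c r' - Dir \<psi> c' r')"
      using Cauchy_Schwarz_ineq2[of "?x - Dir \<psi> c' h" N'] Cauchy_Schwarz_ineq2[of ?x "Q' - Q"]
        Cauchy_Schwarz_ineq2[of ?x "Dir \<psi> c r' - Dir \<psi> c' r'"] by linarith
    also have "\<dots> \<le> (A1 * \<delta> * (a * norm ?x)) * B + norm ?x * (C * \<delta>) + norm ?x * (A1 * \<delta> * (a * B))"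
    proof (intro add_mono mult_mono Qd N' order_refl)
      have "norm (?x - Dir \<psi> c' h) \<le> A1 * norm (c - c') * norm h" by (rule A1(2)[OF c])
      also have "\<dots> \<le> A1 * \<delta> * (a * norm ?x)"
        using A1(1) \<delta> low[OF c(1)] by (intro mult_mono) auto
      finally show "norm (?x - Dir \<psi> c' h) \<le> A1 * \<delta> * (a * norm ?x)" .
      have "norm (Dir \<psi> c r' - Dir \<psi> c' r') \<le> A1 * norm (c - c') * norm r'" by (rule A1(2)[OF c])
      also have "\<dots> \<le> A1 * \<delta> * (a * B)"
        using A1(1) \<delta> r' by (intro mult_mono) auto
      finally show "norm (Dir \<psi> c r' - Dir \<psi> c' r') \<le> A1 * \<delta> * (a * B)" .
    qed (use A1(1) \<delta> a(1) in auto)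
    finally have "norm ?x * norm ?x \<le> ((A1 * a * B + C + A1 * a * B) * \<delta>) * norm ?x"
      by (simp add: power2_norm_eq_inner[symmetric] power2_eq_square algebra_simps)
    then have x: "norm ?x \<le> (A1 * a * B + C + A1 * a * B) * \<delta>"
    proof (cases "norm ?x = 0")
      case True
      have "0 \<le> (A1 * a * B + C + A1 * a * B) * \<delta>"
        using A1(1) a(1) B C \<delta> by (intro mult_nonneg_nonneg add_nonneg_nonneg) auto
      with True show ?thesis by simp
    next
      case False
      then have "0 < norm ?x" by simp
      with \<open>norm ?x * norm ?x \<le> _\<close> show ?thesis by (rule mult_right_le_imp_le)
    qed
    have "norm h \<le> a * norm ?x" by (rule low[OF c(1)])
    also have "\<dots> \<le> a * ((A1 * a * B + C + A1 * a * B) * \<delta>)" by (rule mult_left_mono[OF x a(1)])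
    finally show ?thesis by (simp add: h_def r_def r'_def K_def \<delta>_def mult.assoc)
  qed
  moreover have "K \<ge> 0" using a A1(1) B C by (simp add: K_def)
  ultimately show ?thesis by blast
qed

end

section \<open>The covariant derivative in a slice chart\<close>

context slice_chart
begin

text \<open>The geodesic equation and the equation for a tangent parallel field, read in the chart.\<close>

lemma geodesic_flow:
  assumes c0: "c0 \<in> L" "c0 \<in> W" and b0: "b0 \<in> L" and e0: "e0 \<in> L"
  shows "\<exists>\<epsilon>>0. \<exists>c b e. c 0 = c0 \<and> b 0 = b0 \<and> e 0 = e0 \<and>
    (\<forall>s\<in>{-\<epsilon><..<\<epsilon>}. c s \<in> L \<and> c s \<in> W \<and> b s \<in> L \<and> e s \<in> L \<and>
       (c has_vector_derivative b s) (at s) \<and>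
       (b has_vector_derivative \<Gamma> (c s) (b s) (b s)) (at s) \<and>
       (e has_vector_derivative \<Gamma> (c s) (b s) (e s)) (at s))"
proof -
  let ?P = "orth_proj L"
  obtain \<rho> where \<rho>: "\<rho> > 0" "cball c0 \<rho> \<subseteq> W" using open_W c0(2) open_contains_cball by blast
  define R where "R = norm b0 + norm e0 + \<rho>"
  have R: "R \<ge> 0" using \<rho> by (simp add: R_def)
  obtain K where K: "K \<ge> 0" "\<And>c c' b b' e e'. c \<in> cball c0 \<rho> \<Longrightarrow> c' \<in> cball c0 \<rho> \<Longrightarrow>
    norm b \<le> R \<Longrightarrow> norm b' \<le> R \<Longrightarrow> norm e \<le> R \<Longrightarrow> norm e' \<le> R \<Longrightarrow>
    norm (\<Gamma> c b e - \<Gamma> c' b' e') \<le> K * (norm (c - c') + norm (b - b') + norm (e - e'))"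
    using \<Gamma>_lipschitz[OF \<rho>(2) R] by blast
  \<comment> \<open>Projecting every argument onto \<open>L\<close> extends the system from
    \<open>L\<close> to the whole space, where Picard-Lindeloef applies. The projected components of
    a solution solve the original system, since its right-hand sides already lie in
    \<open>L\<close>.\<close>
  define F where "F z = (?P (fst (snd z)), \<Gamma> (?P (fst z)) (?P (fst (snd z))) (?P (fst (snd z))),
      \<Gamma> (?P (fst z)) (?P (fst (snd z))) (?P (snd (snd z))))" for z :: "'a \<times> 'a \<times> 'a"
  let ?z0 = "(c0, b0, e0)"
  have comp: "norm (fst z) \<le> norm z" "norm (fst (snd z)) \<le> norm z" "norm (snd (snd z)) \<le> norm z"
    for z :: "'a \<times> 'a \<times> 'a"
    using norm_fst_le norm_snd_le order_trans by (metis fst_conv snd_conv prod.collapse)+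
  have Pd: "norm (?P x - ?P y) \<le> norm (x - y)" for x y
    using norm_orth_proj_le[OF L, of "x - y"] by (simp add: linear_diff[OF linear_orth_proj[OF L]])
  have near: "?P (fst z) \<in> cball c0 \<rho>" "norm (?P (fst (snd z))) \<le> R" "norm (?P (snd (snd z))) \<le> R"
    if z: "z \<in> cball ?z0 \<rho>" for z
  proof -
    have d: "norm (z - ?z0) \<le> \<rho>" using z by (simp add: dist_norm norm_minus_commute)
    have "norm (fst z - c0) \<le> \<rho>" "norm (fst (snd z) - b0) \<le> \<rho>" "norm (snd (snd z) - e0) \<le> \<rho>"
      using comp[of "z - ?z0"] d by simp_all
    moreover have "norm (?P (fst z) - c0) \<le> norm (fst z - c0)"
      using Pd[of "fst z" c0] by (simp add: orth_proj_id[OF L c0(1)])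
    moreover have "norm (?P (fst (snd z))) \<le> norm (fst (snd z))" "norm (?P (snd (snd z))) \<le> norm (snd (snd z))"
      by (rule norm_orth_proj_le[OF L])+
    moreover have "norm (fst (snd z)) - norm b0 \<le> norm (fst (snd z) - b0)"
      "norm (snd (snd z)) - norm e0 \<le> norm (snd (snd z) - e0)" by (rule norm_triangle_ineq2)+
    moreover have "0 \<le> norm b0" "0 \<le> norm e0" by (rule norm_ge_zero)+
    ultimately have "norm (?P (fst z) - c0) \<le> \<rho>" "norm (?P (fst (snd z))) \<le> R" "norm (?P (snd (snd z))) \<le> R"
      unfolding R_def by linarith+
    then show "?P (fst z) \<in> cball c0 \<rho>" "norm (?P (fst (snd z))) \<le> R" "norm (?P (snd (snd z))) \<le> R"
      by (simp_all add: dist_norm norm_minus_commute)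
  qed
  have lip: "norm (F z - F z') \<le> (1 + K * 3 + K * 3) * norm (z - z')"
    if z: "z \<in> cball ?z0 \<rho>" "z' \<in> cball ?z0 \<rho>" for z z'
  proof -
    have P: "norm (?P (fst z) - ?P (fst z')) \<le> norm (z - z')"
      "norm (?P (fst (snd z)) - ?P (fst (snd z'))) \<le> norm (z - z')"
      "norm (?P (snd (snd z)) - ?P (snd (snd z'))) \<le> norm (z - z')"
      using comp[of "z - z'"] Pd order_trans by (simp_all, blast+)
    have G: "norm (\<Gamma> (?P (fst z)) (?P (fst (snd z))) e - \<Gamma> (?P (fst z')) (?P (fst (snd z'))) e')
        \<le> K * 3 * norm (z - z')"
      if "norm e \<le> R" "norm e' \<le> R" "norm (e - e') \<le> norm (z - z')" for e e'
    proof -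
      have "norm (\<Gamma> (?P (fst z)) (?P (fst (snd z))) e - \<Gamma> (?P (fst z')) (?P (fst (snd z'))) e')
        \<le> K * (norm (?P (fst z) - ?P (fst z')) + norm (?P (fst (snd z)) - ?P (fst (snd z'))) + norm (e - e'))"
        by (intro K(2) near z that)
      also have "\<dots> \<le> K * (norm (z - z') + norm (z - z') + norm (z - z'))"
        using P that K(1) by (intro mult_left_mono add_mono) auto
      finally show ?thesis by simp
    qed
    have tri: "norm (x, y, w) \<le> norm x + norm y + norm w" for x y w :: 'a
      using norm_Pair_le[of x "(y, w)"] norm_Pair_le[of y w] by linarith
    have "norm (F z - F z') \<le> norm (z - z') + K * 3 * norm (z - z') + K * 3 * norm (z - z')"
      unfolding F_def diff_Pair
      by (rule order_trans[OF tri]) (intro add_mono P G near z)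
    then show ?thesis by (simp add: algebra_simps)
  qed
  have "0 \<le> 1 + K * 3 + K * 3" using K(1) by simp
  from picard_lindelof[OF this \<rho>(1) lip] obtain \<epsilon> z where z: "\<epsilon> > 0" "z 0 = ?z0"
    "\<And>s. s \<in> {-\<epsilon><..<\<epsilon>} \<Longrightarrow> z s \<in> cball ?z0 \<rho> \<and> (z has_vector_derivative F (z s)) (at s)" by blast
  have bl: "bounded_linear (\<lambda>z. ?P (fst z))" "bounded_linear (\<lambda>z. ?P (fst (snd z)))"
    "bounded_linear (\<lambda>z. ?P (snd (snd z)))"
    by (intro bounded_linear_compose[OF bounded_linear_orth_proj[OF L]] bounded_linear_fst
        bounded_linear_compose[OF bounded_linear_fst] bounded_linear_compose[OF bounded_linear_snd] bounded_linear_snd)+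
  show ?thesis
  proof (intro exI conjI ballI)
    show "\<epsilon> > 0" by fact
    show "?P (fst (z 0)) = c0" "?P (fst (snd (z 0))) = b0" "?P (snd (snd (z 0))) = e0"
      using z(2) c0 b0 e0 by (simp_all add: orth_proj_id[OF L])
    fix s assume s: "s \<in> {-\<epsilon><..<\<epsilon>}"
    have PP: "?P (?P x) = ?P x" for x by (intro orth_proj_id orth_proj_in L)
    have cW: "?P (fst (z s)) \<in> W" using near(1)[of "z s"] z(3)[OF s] \<rho>(2) by blast
    show "?P (fst (z s)) \<in> L" "?P (fst (snd (z s))) \<in> L" "?P (snd (snd (z s))) \<in> L"
      by (intro orth_proj_in L)+
    show "?P (fst (z s)) \<in> W" by (rule cW)
    note d = has_vector_derivative_frechet[OF bounded_linear_imp_has_derivative conjunct2[OF z(3)[OF s]]]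
    show "((\<lambda>s. ?P (fst (z s))) has_vector_derivative ?P (fst (snd (z s)))) (at s)"
      using d[OF bl(1)] by (simp add: F_def PP)
    show "((\<lambda>s. ?P (fst (snd (z s)))) has_vector_derivative
        \<Gamma> (?P (fst (z s))) (?P (fst (snd (z s)))) (?P (fst (snd (z s))))) (at s)"
      using d[OF bl(2)] by (simp add: F_def orth_proj_id[OF L \<Gamma>_in[OF cW]])
    show "((\<lambda>s. ?P (snd (snd (z s)))) has_vector_derivative
        \<Gamma> (?P (fst (z s))) (?P (fst (snd (z s)))) (?P (snd (snd (z s))))) (at s)"
      using d[OF bl(3)] by (simp add: F_def orth_proj_id[OF L \<Gamma>_in[OF cW]])
  qed
qed

section \<open>The second fundamental form in a chart and its identification with
  \<open>nabla\<close>\<close>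

definition II :: "'a \<Rightarrow> 'a \<Rightarrow> 'a \<Rightarrow> 'a" where
  "II c b e = Dir2 \<psi> c e b - orth_proj (Dir \<psi> c ` L) (Dir2 \<psi> c e b)"

lemma II_orthogonal: "c \<in> W \<Longrightarrow> l \<in> L \<Longrightarrow> II c b e \<bullet> Dir \<psi> c l = 0"
  unfolding II_def by (rule orth_proj_orthogonal[OF subspace_tangent_image]) auto

text \<open>The term with \<open>\<Gamma>\<close> cancels the tangential part of the second
  derivative of \<open>\<psi>\<close> along the curve, so only a normal vector remains.\<close>

lemma has_vector_derivative_transported:
  assumes "c s \<in> W" "(c has_vector_derivative b) (at s)"
    and "(e has_vector_derivative \<Gamma> (c s) b (e s)) (at s)"
  shows "((\<lambda>s. Dir \<psi> (c s) (e s)) has_vector_derivative II (c s) b (e s)) (at s)"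
  using has_vector_derivative_Dir[OF C_\<psi> open_W assms] by (simp add: D\<psi>_\<Gamma>[OF assms(1)] II_def)

text \<open>A tangent field whose derivative is normal is parallel: its normal component is
  constantly zero and its tangential component is the field itself. With \<open>e = b\<close> the
  field is the velocity, and the curve is a geodesic.\<close>

lemma parallel_along_transported:
  assumes J: "open J" and c: "\<And>s. s \<in> J \<Longrightarrow> c s \<in> L \<and> c s \<in> W \<and> e s \<in> L"
    and d: "\<And>s. s \<in> J \<Longrightarrow> (c has_vector_derivative b s) (at s)"
    and e: "\<And>s. s \<in> J \<Longrightarrow> (e has_vector_derivative \<Gamma> (c s) (b s) (e s)) (at s)"
  shows "parallel_along M J (\<lambda>s. \<psi> (c s)) (\<lambda>s. Dir \<psi> (c s) (e s))"
  unfolding parallel_along_def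
proof (intro ballI exI conjI)
  fix s assume s: "s \<in> J"
  have T: "tangent_space_at M (\<psi> (c r)) = Dir \<psi> (c r) ` L"
    "subspace (Dir \<psi> (c r) ` L)" "Dir \<psi> (c r) (e r) \<in> Dir \<psi> (c r) ` L" if "r \<in> J" for r
    using c[OF that] by (auto intro!: tangent_space_\<psi> subspace_tangent_image)
  have d: "((\<lambda>s. Dir \<psi> (c s) (e s)) has_vector_derivative II (c s) (b s) (e s)) (at s)"
    using c[OF s] by (intro has_vector_derivative_transported d[OF s] e[OF s]) simp
  show "((\<lambda>r. orth_proj (tangent_space_at M (\<psi> (c r))) (Dir \<psi> (c r) (e r)))
      has_vector_derivative II (c s) (b s) (e s)) (at s)"
    by (rule has_vector_derivative_transform_within_open[OF d J s]) (simp_all add: T(1) orth_proj_id[OF T(2,3)])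
  show "((\<lambda>r. orth_proj (normal_space_at M (\<psi> (c r))) (Dir \<psi> (c r) (e r))) has_vector_derivative 0) (at s)"
    by (rule has_vector_derivative_transform_within_open[OF has_vector_derivative_const J s])
       (simp add: normal_space_at_def T(1) orth_proj_orthogonal_comp[OF T(2)] orth_proj_id[OF T(2,3)])
  have "orth_proj (Dir \<psi> (c s) ` L) (II (c s) (b s) (e s)) = 0"
    by (rule orth_proj_eq_0[OF T(2)[OF s]]) (use II_orthogonal c[OF s] in auto)
  then show "orth_proj (tangent_space_at M (\<psi> (c s))) (II (c s) (b s) (e s)) +
      orth_proj (normal_space_at M (\<psi> (c s))) 0 = 0"
    by (simp add: T(1)[OF s] normal_space_at_def orth_proj_eq_0[OF subspace_orthogonal_comp])
qed

lemma nabla_exists: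
  assumes p: "p \<in> M" "p \<in> U" and t: "t \<in> tangent_space_at M p" and y: "y \<in> tangent_space_at M p"
  shows "\<exists>\<epsilon>>0. \<exists>\<gamma> Y. geodesic_on M {-\<epsilon><..<\<epsilon>} \<gamma> \<and> \<gamma> 0 = p \<and> (\<gamma> has_vector_derivative t) (at 0) \<and>
        parallel_along M {-\<epsilon><..<\<epsilon>} \<gamma> Y \<and> Y 0 = y \<and>
        (Y has_vector_derivative II (\<phi> p) (Dir \<phi> p t) (Dir \<phi> p y)) (at 0)"
proof -
  obtain \<epsilon> c b e where \<epsilon>: "\<epsilon> > 0" and z: "c 0 = \<phi> p" "b 0 = Dir \<phi> p t" "e 0 = Dir \<phi> p y"
    and f: "\<And>s. s \<in> {-\<epsilon><..<\<epsilon>} \<Longrightarrow> c s \<in> L \<and> c s \<in> W \<and> b s \<in> L \<and> e s \<in> L \<and>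
       (c has_vector_derivative b s) (at s) \<and>
       (b has_vector_derivative \<Gamma> (c s) (b s) (b s)) (at s) \<and>
       (e has_vector_derivative \<Gamma> (c s) (b s) (e s)) (at s)"
    using geodesic_flow[OF \<phi>_slice[OF p] \<phi>_in[OF p(2)] D\<phi>_tangent[OF p t] D\<phi>_tangent[OF p y]] by blast
  have \<gamma>: "((\<lambda>s. \<psi> (c s)) has_vector_derivative Dir \<psi> (c s) (b s)) (at s)" if "s \<in> {-\<epsilon><..<\<epsilon>}" for s
    by (rule has_vector_derivative_frechet[OF has_derivative_\<psi>]) (use f[OF that] in auto)
  have z0: "0 \<in> {-\<epsilon><..<\<epsilon>}" using \<epsilon> by simp
  show ?thesis
  proof (intro exI conjI)
    show "\<epsilon> > 0" by fact
    show "geodesic_on M {-\<epsilon><..<\<epsilon>} (\<lambda>s. \<psi> (c s))"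
      unfolding geodesic_on_def
    proof (intro exI conjI ballI)
      show "\<psi> (c s) \<in> M" if "s \<in> {-\<epsilon><..<\<epsilon>}" for s using f[OF that] \<psi>_slice by blast
      show "((\<lambda>s. \<psi> (c s)) has_vector_derivative Dir \<psi> (c s) (b s)) (at s)" if "s \<in> {-\<epsilon><..<\<epsilon>}" for s
        by (rule \<gamma>[OF that])
      show "parallel_along M {-\<epsilon><..<\<epsilon>} (\<lambda>s. \<psi> (c s)) (\<lambda>s. Dir \<psi> (c s) (b s))"
        by (rule parallel_along_transported) (use f in auto)
    qed
    show "\<psi> (c 0) = p" by (simp add: z \<psi>_\<phi>[OF p(2)])
    show "((\<lambda>s. \<psi> (c s)) has_vector_derivative t) (at 0)"
      using \<gamma>[OF z0] by (simp add: z D\<psi>_D\<phi>[OF p(2)])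
    show "parallel_along M {-\<epsilon><..<\<epsilon>} (\<lambda>s. \<psi> (c s)) (\<lambda>s. Dir \<psi> (c s) (e s))"
      by (rule parallel_along_transported) (use f in auto)
    show "Dir \<psi> (c 0) (e 0) = y" by (simp add: z D\<psi>_D\<phi>[OF p(2)])
    show "((\<lambda>s. Dir \<psi> (c s) (e s)) has_vector_derivative II (\<phi> p) (Dir \<phi> p t) (Dir \<phi> p y)) (at 0)"
      using has_vector_derivative_transported[of c 0 "b 0" e] f[OF z0] by (simp add: z)
  qed
qed

text \<open>Let \<open>a\<close> and \<open>b\<close> be the derivatives at 0 of the tangential part
  \<open>u\<close> and the normal part \<open>n\<close> of \<open>Y\<close>. Since \<open>n\<close>
  vanishes at 0, \<open>b\<close> is normal; parallelism then forces \<open>b = 0\<close> and makes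
  \<open>a\<close> normal. In the chart, \<open>a\<close> differs from the second derivative of
  \<open>\<psi>\<close> by a tangent vector, so it is the normal part of that derivative.\<close>

lemma nabla_unique:
  assumes p: "p \<in> M" "p \<in> U" and y: "y \<in> tangent_space_at M p"
    and \<epsilon>: "\<epsilon> > 0" and \<gamma>: "geodesic_on M {-\<epsilon><..<\<epsilon>} \<gamma>" "\<gamma> 0 = p" "(\<gamma> has_vector_derivative t) (at 0)"
    and Y: "parallel_along M {-\<epsilon><..<\<epsilon>} \<gamma> Y" "Y 0 = y" "(Y has_vector_derivative w) (at 0)"
  shows "w = II (\<phi> p) (Dir \<phi> p t) (Dir \<phi> p y)"
proof -
  let ?T = "\<lambda>r. tangent_space_at M (\<gamma> r)"
  have \<gamma>M: "\<gamma> s \<in> M" and \<gamma>d: "\<exists>v. (\<gamma> has_vector_derivative v) (at s)" if "s \<in> {-\<epsilon><..<\<epsilon>}" for s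
    using \<gamma>(1) that unfolding geodesic_on_def by blast+
  have "continuous_on {-\<epsilon><..<\<epsilon>} \<gamma>"
    using \<gamma>d has_vector_derivative_continuous by (blast intro: continuous_at_imp_continuous_on)
  define J where "J = {-\<epsilon><..<\<epsilon>} \<inter> \<gamma> -` U"
  have J: "open J" unfolding J_def
    by (rule continuous_open_preimage[OF \<open>continuous_on _ \<gamma>\<close> _ open_U]) simp
  have J0: "0 \<in> J" using \<epsilon> \<gamma>(2) p by (simp add: J_def)
  have \<gamma>J: "\<gamma> r \<in> M" "\<gamma> r \<in> U" if "r \<in> J" for r using that \<gamma>M by (auto simp: J_def)
  have sT: "subspace (?T r)" if "r \<in> J" for r using \<gamma>J[OF that] by (rule subspace_tangent)
  define u where "u r = orth_proj (?T r) (Y r)" for r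
  define n where "n r = orth_proj (normal_space_at M (\<gamma> r)) (Y r)" for r
  obtain a b where a: "(u has_vector_derivative a) (at 0)" and b: "(n has_vector_derivative b) (at 0)"
    and ab: "orth_proj (?T 0) a + orth_proj (normal_space_at M (\<gamma> 0)) b = 0"
    using Y(1) \<epsilon> unfolding parallel_along_def u_def n_def by force
  have n_eq: "n r = Y r - u r" if "r \<in> J" for r
    unfolding n_def u_def normal_space_at_def by (rule orth_proj_orthogonal_comp[OF sT[OF that]])
  have uT: "u r \<in> ?T r" if "r \<in> J" for r unfolding u_def by (rule orth_proj_in[OF sT[OF that]])
  have u0: "u 0 = y" unfolding u_def Y(2) using y sT[OF J0] \<gamma>(2) by (simp add: orth_proj_id)
  have n0: "n 0 = 0" using n_eq[OF J0] u0 Y(2) by simp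
  have "(Y has_vector_derivative a + b) (at 0)"
    by (rule has_vector_derivative_transform_within_open[OF has_vector_derivative_add[OF a b] J J0]) (simp add: n_eq)
  then have w: "w = a + b" using vector_derivative_unique_at[OF Y(3)] by simp
  define c where "c r = \<phi> (\<gamma> r)" for r
  define e where "e r = Dir \<phi> (\<gamma> r) (u r)" for r
  have c: "(c has_vector_derivative Dir \<phi> p t) (at 0)"
    unfolding c_def by (rule has_vector_derivative_frechet[OF _ \<gamma>(3)]) (simp add: \<gamma>(2) has_derivative_\<phi> p)
  have cW: "c r \<in> W" "c r \<in> L" "\<psi> (c r) = \<gamma> r" if "r \<in> J" for r
    using \<gamma>J[OF that] by (auto simp: c_def \<phi>_in \<phi>_slice \<psi>_\<phi>)
  have c0: "c 0 = \<phi> p" by (simp add: c_def \<gamma>(2))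
  have eL: "e r \<in> L" if "r \<in> J" for r
    unfolding e_def by (rule D\<phi>_tangent[OF \<gamma>J[OF that] uT[OF that]])
  define e' where "e' = Dir2 \<phi> (\<gamma> 0) (u 0) t + Dir \<phi> (\<gamma> 0) a"
  have e: "(e has_vector_derivative e') (at 0)"
    unfolding e_def e'_def by (rule has_vector_derivative_Dir[OF C_\<phi> open_U \<gamma>J(2)[OF J0] \<gamma>(3) a])
  have e'L: "e' \<in> L" by (rule has_vector_derivative_in_subspace[OF L J J0 eL e])
  have Q: "a = Dir2 \<psi> (\<phi> p) (Dir \<phi> p y) (Dir \<phi> p t) + Dir \<psi> (\<phi> p) e'"
  proof -
    have "((\<lambda>r. Dir \<psi> (c r) (e r)) has_vector_derivative
        Dir2 \<psi> (c 0) (e 0) (Dir \<phi> p t) + Dir \<psi> (c 0) e') (at 0)"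
      by (rule has_vector_derivative_Dir[OF C_\<psi> open_W cW(1)[OF J0] c e])
    then have "(u has_vector_derivative Dir2 \<psi> (c 0) (e 0) (Dir \<phi> p t) + Dir \<psi> (c 0) e') (at 0)"
      by (rule has_vector_derivative_transform_within_open[OF _ J J0]) (simp add: c_def e_def D\<psi>_D\<phi> \<gamma>J)
    from vector_derivative_unique_at[OF a this] show ?thesis
      by (simp only: c0) (simp add: e_def \<gamma>(2) u0)
  qed
  have T0: "?T 0 = Dir \<psi> (\<phi> p) ` L" using tangent_space_eq[OF p] \<gamma>(2) by simp
  \<comment> \<open>Differentiate \<open>n r \<bullet> Dir \<psi> (c r) l = 0\<close> at 0; the term
    in which the tangent vector is differentiated drops out because \<open>n 0 = 0\<close>.\<close>
  have bT: "b \<bullet> Dir \<psi> (\<phi> p) l = 0" if l: "l \<in> L" for l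
  proof -
    have const: "((\<lambda>r. l) has_vector_derivative 0) (at 0)" by simp
    have D: "((\<lambda>r. Dir \<psi> (c r) l) has_vector_derivative
        Dir2 \<psi> (c 0) l (Dir \<phi> p t) + Dir \<psi> (c 0) 0) (at 0)"
      by (rule has_vector_derivative_Dir[OF C_\<psi> open_W cW(1)[OF J0] c const])
    have "((\<lambda>r. n r \<bullet> Dir \<psi> (c r) l) has_vector_derivative
       n 0 \<bullet> (Dir2 \<psi> (c 0) l (Dir \<phi> p t) + Dir \<psi> (c 0) 0) + b \<bullet> Dir \<psi> (c 0) l) (at 0)"
      by (rule bounded_bilinear.has_vector_derivative[OF bounded_bilinear_inner b D])
    moreover have "((\<lambda>r. n r \<bullet> Dir \<psi> (c r) l) has_vector_derivative 0) (at 0)"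
    proof (rule has_vector_derivative_transform_within_open[OF has_vector_derivative_const J J0])
      fix r assume r: "r \<in> J"
      have "Dir \<psi> (c r) l \<in> ?T r" using l tangent_space_eq[OF \<gamma>J[OF r]] by (simp add: c_def)
      from orth_proj_orthogonal[OF sT[OF r] this, of "Y r"]
      show "0 = n r \<bullet> Dir \<psi> (c r) l" by (simp add: n_eq[OF r] u_def)
    qed
    ultimately show ?thesis using vector_derivative_unique_at n0 c0 by fastforce
  qed
  have Pb: "orth_proj (?T 0) b = 0"
    by (rule orth_proj_eq_0[OF sT[OF J0]]) (use bT T0 in auto)
  have ab': "orth_proj (?T 0) a + b = 0"
    using ab Pb orth_proj_orthogonal_comp[OF sT[OF J0], of b] by (simp add: normal_space_at_def)
  \<comment> \<open>Two orthogonal vectors with sum zero both vanish.\<close>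
  have "b \<bullet> orth_proj (?T 0) a = 0" using orth_proj_in[OF sT[OF J0], of a] bT T0 by auto
  then have "b \<bullet> b = 0" using ab' by (metis add_eq_0_iff inner_minus_right neg_equal_0_iff_equal)
  then have b0: "b = 0" by simp
  then have Pa: "orth_proj (?T 0) a = 0" using ab' by simp
  let ?Q = "Dir2 \<psi> (\<phi> p) (Dir \<phi> p y) (Dir \<phi> p t)"
  have "orth_proj (?T 0) ?Q = ?Q - a"
  proof (rule orth_proj_eqI[OF sT[OF J0]])
    have "?Q - a = Dir \<psi> (\<phi> p) (- e')" using Q by (simp add: linear_neg[OF linear_D\<psi>[OF \<phi>_in[OF p(2)]]])
    then show "?Q - a \<in> ?T 0" using e'L L by (simp add: T0 subspace_neg)
    show "(?Q - (?Q - a)) \<bullet> z = 0" if "z \<in> ?T 0" for z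
      using orth_proj_orthogonal[OF sT[OF J0] that, of a] Pa by simp
  qed
  then show ?thesis unfolding w b0 II_def by (simp add: T0)
qed

lemma nabla_eq:
  assumes p: "p \<in> M" "p \<in> U" and t: "t \<in> tangent_space_at M p" and y: "y \<in> tangent_space_at M p"
  shows "nabla M p t y = II (\<phi> p) (Dir \<phi> p t) (Dir \<phi> p y)"
  unfolding nabla_def
proof (rule the_equality)
  show "\<exists>\<epsilon>>0. \<exists>\<gamma> Y. geodesic_on M {-\<epsilon><..<\<epsilon>} \<gamma> \<and> \<gamma> 0 = p \<and> (\<gamma> has_vector_derivative t) (at 0) \<and>
        parallel_along M {-\<epsilon><..<\<epsilon>} \<gamma> Y \<and> Y 0 = y \<and>
        (Y has_vector_derivative II (\<phi> p) (Dir \<phi> p t) (Dir \<phi> p y)) (at 0)"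
    by (rule nabla_exists[OF assms])
next
  fix w assume "\<exists>\<epsilon>>0. \<exists>\<gamma> Y. geodesic_on M {-\<epsilon><..<\<epsilon>} \<gamma> \<and> \<gamma> 0 = p \<and> (\<gamma> has_vector_derivative t) (at 0) \<and>
        parallel_along M {-\<epsilon><..<\<epsilon>} \<gamma> Y \<and> Y 0 = y \<and> (Y has_vector_derivative w) (at 0)"
  then show "w = II (\<phi> p) (Dir \<phi> p t) (Dir \<phi> p y)"
    using nabla_unique[OF p y] by blast
qed

end

section \<open>Closest points and the shape operator\<close>

text \<open>First order condition: the squared distance to \<open>x\<close> along any curve in
  \<open>M\<close> through \<open>p\<close> has a local minimum at parameter 0.\<close>

lemma closest_imp_normal:
  fixes M :: "'a::euclidean_space set"
  assumes p: "p \<in> M" and min: "\<And>q. q \<in> M \<Longrightarrow> dist x p \<le> dist x q"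
  shows "x - p \<in> normal_space_at M p"
proof -
  have "t \<bullet> (x - p) = 0" if t: "t \<in> tangent_space_at M p" for t
  proof -
    obtain \<epsilon> \<gamma> where \<epsilon>: "\<epsilon> > 0" and \<gamma>: "\<gamma> ` {-\<epsilon><..<\<epsilon>} \<subseteq> M" "\<gamma> 0 = p" "(\<gamma> has_vector_derivative t) (at 0)"
      using t unfolding tangent_space_at_def by blast
    have d: "((\<lambda>s. x - \<gamma> s) has_vector_derivative - t) (at 0)"
      using has_vector_derivative_diff[OF has_vector_derivative_const \<gamma>(3)] by simp
    have "((\<lambda>s. (x - \<gamma> s) \<bullet> (x - \<gamma> s)) has_vector_derivative (x - \<gamma> 0) \<bullet> (- t) + (- t) \<bullet> (x - \<gamma> 0)) (at 0)"
      by (rule bounded_bilinear.has_vector_derivative[OF bounded_bilinear_inner d d])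
    then have "((\<lambda>s. (x - \<gamma> s) \<bullet> (x - \<gamma> s)) has_real_derivative - 2 * (t \<bullet> (x - p))) (at 0)"
      by (simp add: has_real_derivative_iff_has_vector_derivative \<gamma>(2) inner_commute)
    then have "- 2 * (t \<bullet> (x - p)) = 0"
    proof (rule DERIV_local_min[OF _ \<epsilon>], intro allI impI)
      fix s :: real assume s: "\<bar>0 - s\<bar> < \<epsilon>"
      then have "s \<in> {-\<epsilon><..<\<epsilon>}" by auto
      then have "dist x p \<le> dist x (\<gamma> s)" using \<gamma>(1) by (intro min) blast
      then show "(x - \<gamma> 0) \<bullet> (x - \<gamma> 0) \<le> (x - \<gamma> s) \<bullet> (x - \<gamma> s)"
        by (simp add: \<gamma>(2) dist_norm norm_le)
    qed
    then show ?thesis by simp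
  qed
  then show ?thesis by (simp add: normal_space_at_def orthogonal_comp_def orthogonal_def)
qed

text \<open>The residual \<open>m + u - q\<close> is normal at \<open>q\<close> by the first order
  condition and is no longer than \<open>u\<close>. So \<open>(q, m + u - q)\<close> lies in the
  same tube as \<open>(m, u)\<close> and has the same image.\<close>

lemma closest_point_tube_unique:
  fixes M :: "'a::euclidean_space set"
  assumes inj: "inj_on (\<lambda>(p, u). p + u) (normal_tube M \<tau>)"
    and m: "m \<in> M" and u: "u \<in> normal_space_at M m" "norm u < \<tau>"
    and q: "q \<in> M" "\<And>z. z \<in> M \<Longrightarrow> dist (m + u) q \<le> dist (m + u) z"
  shows "q = m"
proof -
  have "norm (m + u - q) \<le> norm u" using q(2)[OF m] by (simp add: dist_norm)
  then have a: "(q, m + u - q) \<in> normal_tube M \<tau>"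
    using closest_imp_normal[OF q] q(1) u(2) by (simp add: normal_tube_def)
  have "(m, u) \<in> normal_tube M \<tau>" using m u by (simp add: normal_tube_def)
  with a have "(q, m + u - q) = (m, u)" by (intro inj_onD[OF inj]) simp_all
  then show ?thesis by (rule Pair_inject)
qed

text \<open>Outside a ball around \<open>p\<close>, compactness leaves a positive gap between the
  distance of \<open>x0\<close> to the remaining points of \<open>M\<close> and its distance to
  \<open>p\<close>. Points near \<open>x0\<close> keep enough of the gap to have their closest point
  inside the ball.\<close>

lemma isCont_closest_point:
  fixes M :: "'a::euclidean_space set"
  assumes M: "compact M" and p: "p \<in> M"
    and uniq: "\<And>q. q \<in> M \<Longrightarrow> (\<And>z. z \<in> M \<Longrightarrow> dist x0 q \<le> dist x0 z) \<Longrightarrow> q = p"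
  shows "closest_point M x0 = p" and "isCont (closest_point M) x0"
proof -
  have cl: "closed M" "M \<noteq> {}" using M p compact_imp_closed by auto
  note cp = closest_point_in_set[OF cl] closest_point_le[OF cl(1)]
  show eq: "closest_point M x0 = p" using uniq cp by blast
  show "isCont (closest_point M) x0"
    unfolding continuous_at_eps_delta eq
  proof (intro allI impI)
    fix \<epsilon> :: real assume \<epsilon>: "\<epsilon> > 0"
    have K: "compact (M - ball p \<epsilon>)" using M by (rule compact_diff) simp
    show "\<exists>d>0. \<forall>x'. dist x' x0 < d \<longrightarrow> dist (closest_point M x') p < \<epsilon>"
    proof (cases "M - ball p \<epsilon> = {}")
      case True
      then have "dist (closest_point M x) p < \<epsilon>" for x using cp(1)[of x] by (auto simp: dist_commute)
      then show ?thesis using zero_less_one by blast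
    next
      case False
      obtain q where q: "q \<in> M - ball p \<epsilon>" "\<And>z. z \<in> M - ball p \<epsilon> \<Longrightarrow> dist x0 q \<le> dist x0 z"
        using distance_attains_inf[OF compact_imp_closed[OF K] False, of x0] by blast
      have qp: "q \<noteq> p" using q(1) \<epsilon> by auto
      have less: "dist x0 p < dist x0 q"
      proof (rule ccontr)
        assume "\<not> dist x0 p < dist x0 q"
        then have "dist x0 q \<le> dist x0 z" if "z \<in> M" for z using cp(2)[OF that, of x0] eq by simp
        then show False using uniq[of q] q(1) qp by blast
      qed
      \<comment> \<open>Half the gap: moving \<open>x0\<close> by less than \<open>d\<close> changes
        a difference of two distances by less than \<open>2 * d\<close>.\<close>
      define d where "d = (dist x0 q - dist x0 p) / 2"
      have "dist (closest_point M x) p < \<epsilon>" if x: "dist x x0 < d" for x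
      proof (rule ccontr)
        assume "\<not> dist (closest_point M x) p < \<epsilon>"
        then have "dist x0 q \<le> dist x0 (closest_point M x)"
          by (intro q(2)) (auto simp: cp dist_commute)
        also have "\<dots> \<le> dist x x0 + dist x (closest_point M x)"
          using dist_triangle[of x0 "closest_point M x" x] by (simp add: dist_commute)
        also have "\<dots> \<le> dist x x0 + dist x p" using cp(2)[OF p, of x] by simp
        also have "\<dots> \<le> dist x x0 + (dist x x0 + dist x0 p)" using dist_triangle[of x p x0] by simp
        finally show False using x by (simp add: d_def)
      qed
      moreover have "d > 0" using less by (simp add: d_def)
      ultimately show ?thesis by blast
    qed
  qed
qed

section \<open>Existence, uniqueness and symmetry of the shape operator\<close>

text \<open>The sum is the adjoint of \<open>g\<close> applied to \<open>q\<close>, written in the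
  standard orthonormal basis.\<close>

lemma transpose_inner:
  fixes g :: "'a::euclidean_space \<Rightarrow> 'b::real_inner"
  assumes "linear g"
  shows "(\<Sum>b\<in>Basis. (q \<bullet> g b) *\<^sub>R b) \<bullet> y = q \<bullet> g y"
proof -
  have "q \<bullet> g y = q \<bullet> (\<Sum>b\<in>Basis. (y \<bullet> b) *\<^sub>R g b)" using linear_sum_basis[OF assms, of y] by metis
  then show ?thesis by (simp add: inner_sum_left inner_sum_right inner_commute mult.commute)
qed

text \<open>On the tangent space the values are tangent and their products with tangent vectors are
  prescribed; on the normal space they are zero. This gives the definite description in
  \<open>shape_operator\<close> its meaning.\<close>

lemma is_shape_operator_unique:
  fixes M :: "'a::euclidean_space set"
  assumes T: "subspace (tangent_space_at M m)"
    and B: "is_shape_operator M m v B" and B': "is_shape_operator M m v B'"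
  shows "B = B'"
proof
  fix x
  let ?T = "tangent_space_at M m"
  define y where "y = orth_proj ?T x"
  have y: "y \<in> ?T" and n: "x - y \<in> normal_space_at M m"
    using orth_proj_in[OF T] orth_proj_orthogonal[OF T, of _ x]
    by (auto simp: y_def normal_space_at_def orthogonal_comp_def orthogonal_def inner_commute)
  have *: "B x = B y" if "is_shape_operator M m v B" for B
  proof -
    have "linear B" "B (x - y) = 0" using that n by (auto simp: is_shape_operator_def)
    then show ?thesis by (simp add: linear_diff)
  qed
  have "B y - B' y \<in> ?T" using B B' y T by (auto simp: is_shape_operator_def intro!: subspace_diff)
  moreover have "(B y - B' y) \<bullet> z = 0" if "z \<in> ?T" for z
    using B B' y that by (simp add: is_shape_operator_def inner_diff_left)
  ultimately have "(B y - B' y) \<bullet> (B y - B' y) = 0" by blast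
  then show "B x = B' x" using *[OF B] *[OF B'] by simp
qed

context slice_chart
begin

lemma normal_D\<psi>:
  assumes "m \<in> M" "m \<in> U" "v \<in> normal_space_at M m" "l \<in> L"
  shows "v \<bullet> Dir \<psi> (\<phi> m) l = 0"
  using assms by (auto simp: normal_space_at_def tangent_space_eq orthogonal_comp_def orthogonal_def inner_commute)

text \<open>The tangential correction in \<open>nabla\<close> is invisible to a normal vector, which
  leaves an expression bilinear in the chart coordinates.\<close>

lemma normal_nabla:
  assumes m: "m \<in> M" "m \<in> U" and v: "v \<in> normal_space_at M m"
    and x: "x \<in> tangent_space_at M m" and y: "y \<in> tangent_space_at M m"
  shows "v \<bullet> nabla M m x y = v \<bullet> Dir2 \<psi> (\<phi> m) (Dir \<phi> m y) (Dir \<phi> m x)"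
proof -
  have "orth_proj (Dir \<psi> (\<phi> m) ` L) z \<in> Dir \<psi> (\<phi> m) ` L" for z
    by (rule orth_proj_in[OF subspace_tangent_image[OF \<phi>_in[OF m(2)]]])
  then have "v \<bullet> orth_proj (Dir \<psi> (\<phi> m) ` L) z = 0" for z
    using normal_D\<psi>[OF m v] by (metis imageE)
  then show ?thesis by (simp add: nabla_eq[OF m x y] II_def inner_diff_right)
qed

lemma shape_operator_exists:
  assumes m: "m \<in> M" "m \<in> U" and v: "v \<in> normal_space_at M m"
  shows "\<exists>B. is_shape_operator M m v B"
proof -
  let ?T = "tangent_space_at M m"
  have T: "subspace ?T" by (rule subspace_tangent[OF m])
  \<comment> \<open>Projecting both arguments extends the bilinear form from the tangent space to
    the whole space, where it is represented by an operator; \<open>B\<close> is that operator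
    followed by the tangential projection.\<close>
  define k where "k x y = v \<bullet> Dir2 \<psi> (\<phi> m) (Dir \<phi> m (orth_proj ?T y)) (Dir \<phi> m (orth_proj ?T x))" for x y
  have l1: "linear (\<lambda>x. Dir2 \<psi> (\<phi> m) y (Dir \<phi> m (orth_proj ?T x)))" for y
    using linear_compose[OF linear_compose[OF linear_orth_proj[OF T] linear_D\<phi>[OF m(2)]]
        linear_Dir2_right[OF C_\<psi> \<phi>_in[OF m(2)]]] by (simp add: o_def)
  have l2: "linear (\<lambda>y. Dir2 \<psi> (\<phi> m) (Dir \<phi> m (orth_proj ?T y)) x)" for x
    using linear_compose[OF linear_compose[OF linear_orth_proj[OF T] linear_D\<phi>[OF m(2)]]
        linear_Dir2_left[OF C_\<psi> open_W \<phi>_in[OF m(2)]]] by (simp add: o_def)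
  have k1: "linear (\<lambda>x. k x y)" for y
    unfolding k_def by (rule linearI) (simp_all add: linear_add[OF l1] linear_cmul[OF l1] inner_add_right)
  define B where "B x = orth_proj ?T (\<Sum>b\<in>Basis. k x b *\<^sub>R b)" for x
  have "linear (\<lambda>x. \<Sum>b\<in>Basis. k x b *\<^sub>R b)"
    by (rule linearI)
       (simp_all add: linear_add[OF k1] linear_cmul[OF k1] scaleR_add_left sum.distrib scaleR_sum_right)
  from linear_compose[OF this linear_orth_proj[OF T]] have "linear B" by (simp add: B_def[abs_def] o_def)
  moreover have "B ` ?T \<subseteq> ?T" using orth_proj_in[OF T] by (auto simp: B_def)
  moreover have "B x \<bullet> y = v \<bullet> nabla M m x y" if x: "x \<in> ?T" and y: "y \<in> ?T" for x y
  proof -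
    have "B x \<bullet> y = (\<Sum>b\<in>Basis. k x b *\<^sub>R b) \<bullet> y"
      unfolding B_def by (rule orth_proj_inner[OF T y])
    also have "\<dots> = k x y"
      unfolding k_def by (rule transpose_inner[OF l2])
    finally show ?thesis
      using x y by (simp add: k_def orth_proj_id[OF T] normal_nabla[OF m v x y])
  qed
  moreover have "B n = 0" if "n \<in> normal_space_at M m" for n
  proof -
    have "orth_proj ?T n = 0"
      using that by (intro orth_proj_eq_0[OF T])
        (auto simp: normal_space_at_def orthogonal_comp_def orthogonal_def inner_commute)
    then have "k n b = 0" for b
      using linear_0[OF linear_D\<phi>[OF m(2)]] linear_0[OF linear_Dir2_right[OF C_\<psi> \<phi>_in[OF m(2)]]]
      by (simp add: k_def)
    then show ?thesis by (simp add: B_def linear_0[OF linear_orth_proj[OF T]])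
  qed
  ultimately show ?thesis unfolding is_shape_operator_def by blast
qed

lemma is_shape_operator_shape_operator:
  assumes m: "m \<in> M" "m \<in> U" and v: "v \<in> normal_space_at M m"
  shows "is_shape_operator M m v (shape_operator M m v)"
  unfolding shape_operator_def
proof (rule theI'[of "is_shape_operator M m v"])
  show "\<exists>!B. is_shape_operator M m v B"
    using shape_operator_exists[OF assms] is_shape_operator_unique[OF subspace_tangent[OF m]] by blast
qed

lemma shape_operator_inner:
  assumes m: "m \<in> M" "m \<in> U" and v: "v \<in> normal_space_at M m" and B: "is_shape_operator M m v B"
    and l: "l \<in> L" "l' \<in> L"
  shows "B (Dir \<psi> (\<phi> m) l) \<bullet> Dir \<psi> (\<phi> m) l' = v \<bullet> Dir2 \<psi> (\<phi> m) l' l"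
proof -
  have T: "Dir \<psi> (\<phi> m) l \<in> tangent_space_at M m" "Dir \<psi> (\<phi> m) l' \<in> tangent_space_at M m"
    using l tangent_space_eq[OF m] by auto
  have "Dir \<phi> m (Dir \<psi> (\<phi> m) x) = x" for x
    using D\<phi>_D\<psi>[OF \<phi>_in[OF m(2)], of x] by (simp add: \<psi>_\<phi>[OF m(2)])
  then show ?thesis
    using B T normal_nabla[OF m v T] by (simp add: is_shape_operator_def)
qed

lemma shape_operator_symmetric:
  assumes m: "m \<in> M" "m \<in> U" and v: "v \<in> normal_space_at M m" and B: "is_shape_operator M m v B"
    and x: "x \<in> tangent_space_at M m" and y: "y \<in> tangent_space_at M m"
  shows "B x \<bullet> y = x \<bullet> B y"
proof -
  obtain l l' where l: "l \<in> L" "x = Dir \<psi> (\<phi> m) l" "l' \<in> L" "y = Dir \<psi> (\<phi> m) l'"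
    using x y tangent_space_eq[OF m] by blast
  have "B x \<bullet> y = B y \<bullet> x"
    unfolding l using shape_operator_inner[OF m v B l(1,3)] shape_operator_inner[OF m v B l(3,1)]
      Dir2_symmetric[OF C_\<psi> open_W \<phi>_in[OF m(2)], of l l'] by simp
  then show ?thesis by (simp add: inner_commute)
qed

section \<open>The second order condition at a closest point\<close>

text \<open>Along the image under \<open>\<psi>\<close> of a line in \<open>L\<close>, half the
  second derivative at 0 of the squared distance is the right-hand side minus the left-hand side.
  The first derivative vanishes at 0 because \<open>u\<close> is normal, so a negative value would
  make the distance decrease just right of 0.\<close>

lemma second_order_condition:
  assumes m: "m \<in> M" "m \<in> U" and u: "u \<in> normal_space_at M m"
    and min: "\<And>q. q \<in> M \<Longrightarrow> norm u \<le> dist (m + u) q" and l: "l \<in> L"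
  shows "u \<bullet> Dir2 \<psi> (\<phi> m) l l \<le> Dir \<psi> (\<phi> m) l \<bullet> Dir \<psi> (\<phi> m) l"
proof (rule ccontr)
  assume neg: "\<not> ?thesis"
  let ?c = "\<lambda>s::real. \<phi> m + s *\<^sub>R l"
  define h where "h s = (m + u - \<psi> (?c s)) \<bullet> (m + u - \<psi> (?c s))" for s
  define k where "k s = - 2 * ((m + u - \<psi> (?c s)) \<bullet> Dir \<psi> (?c s) l)" for s
  have c: "(?c has_vector_derivative l) (at s)" for s by (auto intro!: derivative_eq_intros)
  have "open (?c -` W)"
    by (rule open_vimage[OF open_W]) (intro continuous_intros)
  moreover have "0 \<in> ?c -` W" using \<phi>_in[OF m(2)] by simp
  ultimately obtain \<epsilon> where \<epsilon>: "\<epsilon> > 0" "ball 0 \<epsilon> \<subseteq> ?c -` W" using openE by blast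
  have inW: "?c s \<in> W" if "\<bar>s\<bar> < \<epsilon>" for s
    using \<epsilon>(2) that by (auto simp: subset_iff)
  have d: "((\<lambda>s. m + u - \<psi> (?c s)) has_vector_derivative - Dir \<psi> (?c s) l) (at s)" if "\<bar>s\<bar> < \<epsilon>" for s
    using has_vector_derivative_diff[OF has_vector_derivative_const
        has_vector_derivative_frechet[OF has_derivative_\<psi>[OF inW[OF that]] c]] by simp
  have h: "(h has_real_derivative k s) (at s)" if "\<bar>s\<bar> < \<epsilon>" for s
    using bounded_bilinear.has_vector_derivative[OF bounded_bilinear_inner d[OF that] d[OF that]]
    by (simp add: has_real_derivative_iff_has_vector_derivative h_def[abs_def] k_def inner_commute)
  have const: "((\<lambda>r. l) has_vector_derivative 0) (at 0)" by simp
  have W0: "?c 0 \<in> W" using inW[of 0] \<epsilon>(1) by simp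
  have "((\<lambda>s. Dir \<psi> (?c s) l) has_vector_derivative Dir2 \<psi> (?c 0) l l + Dir \<psi> (?c 0) 0) (at 0)"
    by (rule has_vector_derivative_Dir[OF C_\<psi> open_W W0 c const])
  then have D: "((\<lambda>s. Dir \<psi> (?c s) l) has_vector_derivative Dir2 \<psi> (\<phi> m) l l) (at 0)"
    using linear_0[OF linear_D\<psi>[OF \<phi>_in[OF m(2)]]] by simp
  have d0: "((\<lambda>s. m + u - \<psi> (?c s)) has_vector_derivative - Dir \<psi> (\<phi> m) l) (at 0)"
    using d[of 0] \<epsilon>(1) by simp
  have "((\<lambda>s. (m + u - \<psi> (?c s)) \<bullet> Dir \<psi> (?c s) l) has_vector_derivative
     (m + u - \<psi> (?c 0)) \<bullet> Dir2 \<psi> (\<phi> m) l l + (- Dir \<psi> (\<phi> m) l) \<bullet> Dir \<psi> (?c 0) l) (at 0)"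
    by (rule bounded_bilinear.has_vector_derivative[OF bounded_bilinear_inner d0 D])
  then have "((\<lambda>s. (m + u - \<psi> (?c s)) \<bullet> Dir \<psi> (?c s) l) has_real_derivative
      u \<bullet> Dir2 \<psi> (\<phi> m) l l - Dir \<psi> (\<phi> m) l \<bullet> Dir \<psi> (\<phi> m) l) (at 0)"
    by (simp add: has_real_derivative_iff_has_vector_derivative \<psi>_\<phi>[OF m(2)])
  from DERIV_cmult[OF this, of "-2"]
  have k: "(k has_real_derivative - 2 * (u \<bullet> Dir2 \<psi> (\<phi> m) l l - Dir \<psi> (\<phi> m) l \<bullet> Dir \<psi> (\<phi> m) l)) (at 0)"
    by (simp only: k_def[abs_def])
  have k0: "k 0 = 0" using normal_D\<psi>[OF m u l] by (simp add: k_def \<psi>_\<phi>[OF m(2)])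
  obtain d where d: "d > 0" "\<And>s. 0 < s \<Longrightarrow> s < d \<Longrightarrow> k s < 0"
    using DERIV_neg_dec_right[OF k] neg k0 by auto
  define \<delta> where "\<delta> = min d \<epsilon> / 2"
  have \<delta>: "0 < \<delta>" "\<delta> < d" "\<delta> < \<epsilon>" using d(1) \<epsilon>(1) by (auto simp: \<delta>_def)
  have "h \<delta> < h 0"
  proof (rule DERIV_neg_imp_decreasing_open[OF \<delta>(1)])
    show "\<exists>y. (h has_real_derivative y) (at s) \<and> y < 0" if "0 < s" "s < \<delta>" for s
      using h[of s] d(2)[of s] that \<delta> by auto
    show "continuous_on {0..\<delta>} h"
      using \<delta> by (intro continuous_at_imp_continuous_on ballI DERIV_isCont[OF h]) auto
  qed
  moreover have "h 0 = u \<bullet> u" by (simp add: h_def \<psi>_\<phi>[OF m(2)])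
  moreover have "u \<bullet> u \<le> h \<delta>"
  proof -
    have "?c \<delta> \<in> L" using \<phi>_slice[OF m] l L by (simp add: subspace_add subspace_scale)
    then have "\<psi> (?c \<delta>) \<in> M" using inW[of \<delta>] \<delta> by (intro \<psi>_slice) auto
    from min[OF this] show ?thesis by (simp add: h_def dist_norm norm_le)
  qed
  ultimately show False by simp
qed

end

section \<open>The derivative of the closest point projection\<close>

context slice_chart
begin

text \<open>Differentiate \<open>Dir \<phi> (\<psi> z) (Dir \<psi> z l) = l\<close> in
  \<open>z\<close>. This trades the second derivative of \<open>\<phi>\<close>, which occurs in the
  derivative of \<open>tube\<close>, for that of \<open>\<psi>\<close>, which gives the shape
  operator.\<close>

lemma Dir2_\<phi>_D\<psi>:
  assumes c: "c \<in> W"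
  shows "Dir2 \<phi> (\<psi> c) (Dir \<psi> c l) (Dir \<psi> c d) = - Dir \<phi> (\<psi> c) (Dir2 \<psi> c l d)"
proof -
  have "((\<lambda>z. Dir \<phi> (\<psi> z) (Dir \<psi> z l)) has_derivative
      (\<lambda>h. Dir2 \<phi> (\<psi> c) (Dir \<psi> c l) (Dir \<psi> c h) + Dir \<phi> (\<psi> c) (Dir2 \<psi> c l h))) (at c)"
    by (rule has_derivative_Dir[OF C_\<phi> open_U \<psi>_in[OF c] has_derivative_\<psi>[OF c]
        C_on_has_derivative[OF C_on_Dir[OF C_\<psi>] c]])
  moreover have "((\<lambda>z. Dir \<phi> (\<psi> z) (Dir \<psi> z l)) has_derivative (\<lambda>h. 0)) (at c)"
    by (rule has_derivative_transform_within_open[OF has_derivative_const open_W c]) (simp add: D\<phi>_D\<psi>)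
  ultimately have "(\<lambda>h. Dir2 \<phi> (\<psi> c) (Dir \<psi> c l) (Dir \<psi> c h) + Dir \<phi> (\<psi> c) (Dir2 \<psi> c l h)) = (\<lambda>h. 0)"
    by (rule has_derivative_unique)
  from fun_cong[OF this, of d] show ?thesis by (simp add: eq_neg_iff_add_eq_0)
qed

text \<open>Since \<open>Dir \<phi> p\<close> maps the tangent space at \<open>p\<close> onto \<open>L\<close>, its transpose maps the orthogonal
  complement of \<open>L\<close> onto the normal space at \<open>p\<close>. So \<open>tube\<close> is the map \<open>(p, u) \<mapsto> p + u\<close> in
  coordinates, and \<open>tube_coords\<close> inverts it as long as \<open>closest_point\<close> recovers the foot point.\<close>

definition tube :: "'a \<Rightarrow> 'a" where
  "tube w = \<psi> (orth_proj L w) + (\<Sum>b\<in>Basis. ((w - orth_proj L w) \<bullet> Dir \<phi> (\<psi> (orth_proj L w)) b) *\<^sub>R b)"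

definition tube_coords :: "'a \<Rightarrow> 'a" where
  "tube_coords x = \<phi> (closest_point M x)
     + (\<Sum>b\<in>Basis. ((x - closest_point M x) \<bullet> Dir \<psi> (\<phi> (closest_point M x)) b) *\<^sub>R b)"

text \<open>The adjoint of \<open>Dir \<psi> (\<phi> p)\<close> sends a normal vector into the
  orthogonal complement of \<open>L\<close>, so projecting onto \<open>L\<close> recovers
  \<open>\<phi> p\<close>. The adjoint of \<open>Dir \<phi> p\<close> undoes it, because
  \<open>Dir \<psi> (\<phi> p)\<close> inverts \<open>Dir \<phi> p\<close>.\<close>

lemma tube_coords_proj:
  assumes p: "p \<in> M" "p \<in> U" and n: "x - p \<in> normal_space_at M p" and cp: "closest_point M x = p"
  shows "orth_proj L (tube_coords x) = \<phi> p" and "tube (tube_coords x) = x"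
proof -
  let ?q = "\<Sum>b\<in>Basis. ((x - p) \<bullet> Dir \<psi> (\<phi> p) b) *\<^sub>R b"
  have q: "?q \<bullet> y = (x - p) \<bullet> Dir \<psi> (\<phi> p) y" for y
    by (rule transpose_inner[OF linear_D\<psi>[OF \<phi>_in[OF p(2)]]])
  have tc: "tube_coords x = \<phi> p + ?q" by (simp add: tube_coords_def cp)
  show P: "orth_proj L (tube_coords x) = \<phi> p"
  proof (rule orth_proj_eqI[OF L \<phi>_slice[OF p]])
    show "(tube_coords x - \<phi> p) \<bullet> z = 0" if "z \<in> L" for z
      unfolding tc add_diff_cancel_left' q by (rule normal_D\<psi>[OF p n that])
  qed
  have "(\<Sum>b\<in>Basis. (?q \<bullet> Dir \<phi> p b) *\<^sub>R b) = x - p"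
    unfolding q D\<psi>_D\<phi>[OF p(2)] by (rule euclidean_representation)
  then show "tube (tube_coords x) = x"
    unfolding tube_def P \<psi>_\<phi>[OF p(2)] unfolding tc add_diff_cancel_left' by simp
qed

text \<open>The adjoint of \<open>Dir \<phi>\<close> is taken at a point that moves with
  \<open>orth_proj L w\<close>; differentiating it produces the term with
  \<open>Dir2 \<phi>\<close>, from which the shape operator arises.\<close>

lemma has_derivative_tube:
  assumes w: "orth_proj L w = c" "c \<in> W"
  shows "(tube has_derivative (\<lambda>h. Dir \<psi> c (orth_proj L h) +
     (\<Sum>b\<in>Basis. ((h - orth_proj L h) \<bullet> Dir \<phi> (\<psi> c) b
        + (w - c) \<bullet> Dir2 \<phi> (\<psi> c) b (Dir \<psi> c (orth_proj L h))) *\<^sub>R b))) (at w)"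
proof -
  have P: "(orth_proj L has_derivative orth_proj L) (at w)"
    by (rule bounded_linear_imp_has_derivative[OF bounded_linear_orth_proj[OF L]])
  have 1: "((\<lambda>w. \<psi> (orth_proj L w)) has_derivative (\<lambda>h. Dir \<psi> c (orth_proj L h))) (at w)"
    by (rule has_derivative_compose[OF P, of \<psi> "Dir \<psi> c"]) (simp add: w has_derivative_\<psi>)
  have 2: "((\<lambda>w. Dir \<phi> (\<psi> (orth_proj L w)) b) has_derivative
      (\<lambda>h. Dir2 \<phi> (\<psi> c) b (Dir \<psi> c (orth_proj L h)))) (at w)" for b
    by (rule has_derivative_compose[OF 1, of "\<lambda>x. Dir \<phi> x b" "Dir2 \<phi> (\<psi> c) b"])
       (simp only: w(1), rule C_on_has_derivative[OF C_on_Dir[OF C_\<phi>] \<psi>_in[OF w(2)]])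
  have 3: "((\<lambda>w. w - orth_proj L w) has_derivative (\<lambda>h. h - orth_proj L h)) (at w)"
    by (rule has_derivative_diff[OF has_derivative_ident P])
  have "((\<lambda>w. \<psi> (orth_proj L w) + (\<Sum>b\<in>Basis. ((w - orth_proj L w) \<bullet> Dir \<phi> (\<psi> (orth_proj L w)) b) *\<^sub>R b))
     has_derivative (\<lambda>h. Dir \<psi> c (orth_proj L h) +
     (\<Sum>b\<in>Basis. ((w - orth_proj L w) \<bullet> Dir2 \<phi> (\<psi> c) b (Dir \<psi> c (orth_proj L h))
       + (h - orth_proj L h) \<bullet> Dir \<phi> (\<psi> (orth_proj L w)) b) *\<^sub>R b))) (at w)"
    by (intro has_derivative_add 1 has_derivative_sum has_derivative_scaleR_left has_derivative_inner 2 3)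
  then show ?thesis by (simp add: tube_def[abs_def] w(1) add.commute)
qed

lemma isCont_tube_coords:
  assumes cont: "isCont (closest_point M) x" and U: "closest_point M x \<in> U"
  shows "isCont tube_coords x"
proof -
  have \<phi>: "isCont (\<lambda>x. \<phi> (closest_point M x)) x"
    by (rule isCont_o2[OF cont has_derivative_continuous[OF has_derivative_\<phi>[OF U]]])
  have "isCont (\<lambda>x. Dir \<psi> (\<phi> (closest_point M x)) b) x" for b
    by (rule isCont_o2[OF \<phi> has_derivative_continuous[OF C_on_has_derivative[OF C_on_Dir[OF C_\<psi>] \<phi>_in[OF U]]]])
  then show ?thesis
    unfolding tube_coords_def[abs_def] by (intro continuous_intros \<phi> cont)
qed

text \<open>Tested against tangent vectors, the derivative of \<open>tube\<close> acts as
  \<open>I - B\<close> on \<open>Dir \<psi> (\<phi> m) (orth_proj L h)\<close> and does not see the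
  component of \<open>h\<close> orthogonal to \<open>L\<close>. This triangular form gives its
  injectivity, and the same tangential equation identifies the derivative of the closest point
  map.\<close>

lemma has_derivative_closest_point:
  fixes B :: "'a \<Rightarrow> 'a"
  assumes clM: "closed M" and m: "m \<in> M" "m \<in> U" and v: "v \<in> normal_space_at M m"
    and B: "is_shape_operator M m v B"
    and pos: "\<And>t. t \<in> tangent_space_at M m \<Longrightarrow> (t - B t) \<bullet> t = 0 \<Longrightarrow> t = 0"
    and cp: "closest_point M (m + v) = m" and cont: "isCont (closest_point M) (m + v)"
  shows "bij (\<lambda>x. x - B x)" and "(closest_point M has_derivative
     orth_proj (tangent_space_at M m) \<circ> inv (\<lambda>x. x - B x)) (at (m + v))"
proof -
  let ?T = "tangent_space_at M m" and ?c = "\<phi> m" and ?P = "orth_proj L"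
  let ?A = "Dir \<psi> ?c"
  have T: "subspace ?T" by (rule subspace_tangent[OF m])
  have Teq: "?T = ?A ` L" by (rule tangent_space_eq[OF m])
  have linB: "linear B" and BT: "\<And>t. t \<in> ?T \<Longrightarrow> B t \<in> ?T" and BN: "\<And>n. n \<in> normal_space_at M m \<Longrightarrow> B n = 0"
    using B by (auto simp: is_shape_operator_def)
  have B_proj: "B x = B (orth_proj ?T x)" for x
  proof -
    have "x - orth_proj ?T x \<in> normal_space_at M m"
      using orth_proj_orthogonal[OF T, of _ x]
      by (auto simp: normal_space_at_def orthogonal_comp_def orthogonal_def inner_commute)
    from BN[OF this] show ?thesis by (simp add: linear_diff[OF linB])
  qed
  have linI: "linear (\<lambda>x. x - B x)" by (intro linear_compose_sub linear_ident linB)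
  have nondeg: "t = 0" if t: "t \<in> ?T" and o: "\<And>y. y \<in> ?T \<Longrightarrow> (t - B t) \<bullet> y = 0" for t
    using pos[OF t o[OF t]] .
  have "inj (\<lambda>x. x - B x)"
    unfolding linear_injective_0[OF linI]
  proof (intro allI impI)
    fix x assume x: "x - B x = 0"
    then have "x = B x" by simp
    then have "x \<in> ?T" using B_proj[of x] BT[OF orth_proj_in[OF T, of x]] by metis
    then show "x = 0" by (rule nondeg) (simp add: x)
  qed
  then show bij: "bij (\<lambda>x. x - B x)"
    using linear_injective_imp_surjective[OF linI] by (simp add: bij_def)
  have cW: "?c \<in> W" by (rule \<phi>_in[OF m(2)])
  have \<psi>c: "\<psi> ?c = m" by (rule \<psi>_\<phi>[OF m(2)])
  have linA: "linear ?A" by (rule linear_D\<psi>[OF cW])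
  have DD: "Dir \<phi> m (?A x) = x" for x using D\<phi>_D\<psi>[OF cW] \<psi>c by simp
  define w where "w = tube_coords (m + v)"
  have w: "?P w = ?c"
    using tube_coords_proj(1)[OF m _ cp] v by (simp add: w_def)
  have wv: "(w - ?c) \<bullet> y = v \<bullet> ?A y" for y
    unfolding w_def tube_coords_def cp using transpose_inner[OF linA, of v y] by simp
  define f' where "f' h = ?A (?P h) +
     (\<Sum>b\<in>Basis. ((h - ?P h) \<bullet> Dir \<phi> m b + (w - ?c) \<bullet> Dir2 \<phi> m b (?A (?P h))) *\<^sub>R b)" for h
  have df: "(tube has_derivative f') (at w)"
    using has_derivative_tube[OF w cW] unfolding \<psi>c f'_def[abs_def] .
  have linf: "linear f'" by (rule has_derivative_linear[OF df])
  have f'_inner: "f' h \<bullet> y = ?A (?P h) \<bullet> y + (h - ?P h) \<bullet> Dir \<phi> m y + (w - ?c) \<bullet> Dir2 \<phi> m y (?A (?P h))" for h y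
  proof -
    have "f' h = ?A (?P h) + (\<Sum>b\<in>Basis. ((h - ?P h) \<bullet> Dir \<phi> m b) *\<^sub>R b)
        + (\<Sum>b\<in>Basis. ((w - ?c) \<bullet> Dir2 \<phi> m b (?A (?P h))) *\<^sub>R b)"
      by (simp add: f'_def scaleR_add_left sum.distrib)
    then show ?thesis
      by (simp add: inner_add_left transpose_inner[OF linear_D\<phi>[OF m(2)]]
          transpose_inner[OF linear_Dir2_left[OF C_\<phi> open_U m(2)]])
  qed
  have PL: "?P h \<in> L" for h by (rule orth_proj_in[OF L])
  have key: "f' h \<bullet> y = (?A (?P h) - B (?A (?P h))) \<bullet> y" if y: "y \<in> ?T" for h y
  proof -
    obtain l where l: "l \<in> L" "y = ?A l" using y Teq by blast
    \<comment> \<open>The sign in \<open>Dir2_\<phi>_D\<psi>\<close> is the origin of the minus in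
      \<open>I - B\<close>.\<close>
    have "(w - ?c) \<bullet> Dir2 \<phi> m (?A l) (?A (?P h)) = - (v \<bullet> Dir2 \<psi> ?c l (?P h))"
      using Dir2_\<phi>_D\<psi>[OF cW, of l "?P h"] D\<psi>_D\<phi>[OF m(2)] by (simp add: \<psi>c wv)
    also have "v \<bullet> Dir2 \<psi> ?c l (?P h) = B (?A (?P h)) \<bullet> ?A l"
      by (rule shape_operator_inner[OF m v B PL l(1), symmetric])
    finally have "(w - ?c) \<bullet> Dir2 \<phi> m (?A l) (?A (?P h)) = - (B (?A (?P h)) \<bullet> ?A l)" .
    then show ?thesis
      unfolding f'_inner l(2) DD using orth_proj_orthogonal[OF L l(1), of h] by (simp add: inner_diff_left)
  qed
  have AT: "?A (?P h) \<in> ?T" for h using Teq PL by blast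
  \<comment> \<open>Tangent test vectors give \<open>?P h = 0\<close>; for such \<open>h\<close> the
    test vector \<open>?A h\<close> returns \<open>h \<bullet> h\<close>.\<close>
  have "inj f'"
    unfolding linear_injective_0[OF linf]
  proof (intro allI impI)
    fix h assume h: "f' h = 0"
    have "?A (?P h) = 0"
      by (rule nondeg[OF AT]) (use key[of _ h] h in simp)
    then have P0: "?P h = 0" using DD[of "?P h"] linear_0[OF linear_D\<phi>[OF m(2)]] by simp
    have "f' h \<bullet> ?A h = h \<bullet> h"
      unfolding f'_inner P0 DD linear_0[OF linA] linear_0[OF linear_Dir2_right[OF C_\<phi> m(2)]] by simp
    then show "h = 0" using h by simp
  qed
  then obtain g' where g': "linear g'" "g' \<circ> f' = id"
    using linear_injective_left_inverse[OF linf] by blast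
  have fg: "f' (g' h) = h" for h
    using linear_inverse_left[OF linf g'(1)] g'(2) by (metis comp_apply id_apply)
  obtain S where S: "open S" "m + v \<in> S" "\<And>x. x \<in> S \<Longrightarrow> closest_point M x \<in> U"
    using cont open_U m(2) cp unfolding continuous_at_open by metis
  have near: "?P (tube_coords x) = \<phi> (closest_point M x)" "tube (tube_coords x) = x" if "x \<in> S" for x
  proof -
    have M: "closest_point M x \<in> M" using closest_point_in_set[OF clM] m by blast
    have "x - closest_point M x \<in> normal_space_at M (closest_point M x)"
      by (rule closest_imp_normal[OF M closest_point_le[OF clM]])
    from tube_coords_proj[OF M S(3)[OF that] this refl]
    show "?P (tube_coords x) = \<phi> (closest_point M x)" "tube (tube_coords x) = x" .
  qed
  have dg: "(tube_coords has_derivative g') (at (m + v))"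
  proof (rule has_derivative_inverse_basic[OF _ _ g'(2) _ S(1,2)])
    show "(tube has_derivative f') (at (tube_coords (m + v)))" using df by (simp add: w_def)
    show "bounded_linear g'" using g'(1) linear_conv_bounded_linear by blast
    show "isCont tube_coords (m + v)" by (rule isCont_tube_coords[OF cont]) (simp add: cp m)
  qed (rule near)
  have "(?P has_derivative ?P) (at (tube_coords (m + v)))"
    by (rule bounded_linear_imp_has_derivative[OF bounded_linear_orth_proj[OF L]])
  from has_derivative_compose[OF dg this]
  have "((\<lambda>x. ?P (tube_coords x)) has_derivative (\<lambda>h. ?P (g' h))) (at (m + v))" .
  then have "((\<lambda>x. \<psi> (?P (tube_coords x))) has_derivative (\<lambda>h. ?A (?P (g' h)))) (at (m + v))"
    by (rule has_derivative_compose) (use has_derivative_\<psi>[OF cW] w in \<open>simp add: w_def\<close>)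
  then have "(closest_point M has_derivative (\<lambda>h. ?A (?P (g' h)))) (at (m + v))"
    by (rule has_derivative_transform_within_open[OF _ S(1,2)]) (simp add: near \<psi>_\<phi> S(3))
  \<comment> \<open>Both sides are tangent vectors \<open>t\<close> with
    \<open>(t - B t) \<bullet> y = h \<bullet> y\<close> for all tangent \<open>y\<close>, and
    \<open>nondeg\<close> allows only one such \<open>t\<close>.\<close>
  moreover have "?A (?P (g' h)) = orth_proj ?T (inv (\<lambda>x. x - B x) h)" for h
  proof -
    let ?a = "?A (?P (g' h))"
    define x where "x = inv (\<lambda>x. x - B x) h"
    define t where "t = orth_proj ?T x"
    have x: "x - B x = h" unfolding x_def by (rule surj_f_inv_f[OF bij_is_surj[OF bij]])
    have tT: "t \<in> ?T" unfolding t_def by (rule orth_proj_in[OF T])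
    have "t - ?a = 0"
    proof (rule nondeg)
      show "t - ?a \<in> ?T" by (rule subspace_diff[OF T tT AT])
      fix y assume y: "y \<in> ?T"
      have "(?a - B ?a) \<bullet> y = h \<bullet> y" using key[OF y, of "g' h"] by (simp add: fg)
      also have "\<dots> = x \<bullet> y - B t \<bullet> y" using x B_proj[of x] by (auto simp: t_def inner_diff_left)
      also have "\<dots> = (t - B t) \<bullet> y" by (simp add: t_def inner_diff_left orth_proj_inner[OF T y])
      finally show "((t - ?a) - B (t - ?a)) \<bullet> y = 0"
        by (simp add: linear_diff[OF linB] inner_diff_left)
    qed
    then show ?thesis by (simp add: t_def x_def)
  qed
  ultimately show "(closest_point M has_derivative orth_proj ?T \<circ> inv (\<lambda>x. x - B x)) (at (m + v))"
    by (simp add: o_def)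
qed

end

lemma smooth_submanifold_chart:
  assumes "smooth_submanifold k M" "m \<in> M"
  obtains U W L \<phi> \<psi> where "slice_chart M U W L \<phi> \<psi>" "m \<in> U"
proof -
  from bspec[OF assms(1)[unfolded smooth_submanifold_def] assms(2)]
  obtain U W and \<phi> \<psi> :: "'a \<Rightarrow> 'a" and L where "open U \<and> m \<in> U \<and> open W \<and> homeomorphism U W \<phi> \<psi> \<and>
        smooth_on U \<phi> \<and> smooth_on W \<psi> \<and> subspace L \<and> dim L = k \<and> \<phi> ` (M \<inter> U) = L \<inter> W"
    by (elim exE) (rule that)
  then show thesis by (intro that[of U W L \<phi> \<psi>]) (simp_all add: slice_chart_def)
qed

text \<open>The assumption on \<open>t\<close> turns the second order condition for the normal
  vector \<open>s *\<^sub>R v\<close> into \<open>s * (t \<bullet> t) \<le> t \<bullet> t\<close>,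
  which for \<open>s > 1\<close> leaves only \<open>t = 0\<close>.\<close>

lemma shape_operator_less_identity:
  assumes chart: "slice_chart M U W L \<phi> \<psi>" and m: "m \<in> M" "m \<in> U" and v: "v \<in> normal_space_at M m"
    and B: "is_shape_operator M m v B"
    and \<tau>: "norm v < \<tau>" "inj_on (\<lambda>(p, u). p + u) (normal_tube M \<tau>)" and M: "compact M"
    and t: "t \<in> tangent_space_at M m" and Bt: "(t - B t) \<bullet> t = 0"
  shows "t = 0"
proof -
  interpret slice_chart M U W L \<phi> \<psi> by (rule chart)
  obtain l where l: "l \<in> L" "t = Dir \<psi> (\<phi> m) l" using t tangent_space_eq[OF m] by blast
  have N: "subspace (normal_space_at M m)" unfolding normal_space_at_def by (rule subspace_orthogonal_comp)
  \<comment> \<open>For \<open>v = 0\<close> every factor is admissible and 2 is taken; otherwise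
    any number strictly between 1 and \<open>\<tau> / norm v\<close> will do.\<close>
  obtain s where s: "s > 1" "s * norm v < \<tau>"
  proof (cases "norm v = 0")
    case True
    then show ?thesis using that[of 2] \<tau>(1) by simp
  next
    case False
    then have nv: "norm v > 0" by simp
    then have "1 < \<tau> / norm v" using \<tau>(1) by (simp add: field_simps)
    then obtain s where "1 < s" "s < \<tau> / norm v" using dense by blast
    then show ?thesis using that[of s] nv by (simp add: field_simps)
  qed
  define u where "u = s *\<^sub>R v"
  have u: "u \<in> normal_space_at M m" unfolding u_def by (rule subspace_scale[OF N v])
  have nu: "norm u < \<tau>" using s by (simp add: u_def)
  have cl: "closed M" "M \<noteq> {}" using M m compact_imp_closed by auto
  have "closest_point M (m + u) = m"
    by (rule isCont_closest_point(1)[OF M m(1) closest_point_tube_unique[OF \<tau>(2) m(1) u nu]])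
  then have min: "norm u \<le> dist (m + u) q" if "q \<in> M" for q
    using closest_point_le[OF cl(1) that, of "m + u"] by (simp add: dist_norm)
  have "s * (v \<bullet> Dir2 \<psi> (\<phi> m) l l) \<le> t \<bullet> t"
    using second_order_condition[OF m u min l(1)] by (simp add: u_def l(2))
  moreover have "v \<bullet> Dir2 \<psi> (\<phi> m) l l = t \<bullet> t"
    using shape_operator_inner[OF m v B l(1) l(1)] Bt by (simp add: l(2) inner_diff_left)
  ultimately have "(s - 1) * (t \<bullet> t) \<le> 0" by (simp add: algebra_simps)
  then have "t \<bullet> t \<le> 0" using s(1) by (simp add: mult_le_0_iff)
  then show ?thesis by (metis inner_eq_zero_iff inner_ge_zero order_antisym)
qed

theorem theorem2p7:
  fixes M :: "'a::euclidean_space set" and k :: nat and m v :: 'a and B :: "'a \<Rightarrow> 'a"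
  assumes "smooth_submanifold k M" and "compact M"
    and "m \<in> M"
    and "v \<in> normal_space_at M m" and "ereal (norm v) < reach M"
    and "B = shape_operator M m v"
  shows "is_shape_operator M m v B \<and>
    (\<forall>x\<in>tangent_space_at M m. \<forall>y\<in>tangent_space_at M m. B x \<bullet> y = x \<bullet> B y) \<and>
    bij (\<lambda>x. x - B x) \<and>
    closest_point M differentiable (at (m + v)) \<and>
    closest_point M differentiable (at m) \<and>
    frechet_derivative (closest_point M) (at (m + v)) =
      orth_proj (tangent_space_at M m) \<circ> inv (\<lambda>x. x - B x) \<and>
    orth_proj (tangent_space_at M m) \<circ> inv (\<lambda>x. x - B x) =
      (\<lambda>x. frechet_derivative (closest_point M) (at m) x + B (inv (\<lambda>x. x - B x) x))"
proof -
  let ?T = "tangent_space_at M m"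
  obtain U W L \<phi> \<psi> where chart: "slice_chart M U W L \<phi> \<psi>" and mU: "m \<in> U"
    using smooth_submanifold_chart[OF assms(1,3)] by blast
  interpret slice_chart M U W L \<phi> \<psi> by (rule chart)
  note m = \<open>m \<in> M\<close> mU
  have T: "subspace ?T" by (rule subspace_tangent[OF m])
  \<comment> \<open>The reach is a supremum of admissible radii, so one of them already exceeds
    \<open>norm v\<close>.\<close>
  obtain \<tau> where \<tau>: "norm v < \<tau>" "inj_on (\<lambda>(p, u). p + u) (normal_tube M \<tau>)"
    using assms(5) unfolding reach_def less_SUP_iff by auto
  have clM: "closed M" using assms(2) by (rule compact_imp_closed)
  \<comment> \<open>Stated for a general normal vector because it serves twice: at \<open>v\<close>,
    and at 0 with the zero operator, which identifies the derivative at \<open>m\<close> with the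
    tangential projection.\<close>
  have main: "bij (\<lambda>x. x - C x) \<and> (closest_point M has_derivative orth_proj ?T \<circ> inv (\<lambda>x. x - C x)) (at (m + u))"
    if u: "u \<in> normal_space_at M m" "norm u < \<tau>" and C: "is_shape_operator M m u C" for u C
  proof -
    note uniq = closest_point_tube_unique[OF \<tau>(2) m(1) u]
    note cp = isCont_closest_point[OF assms(2) m(1) uniq]
    note less = shape_operator_less_identity[OF chart m u(1) C u(2) \<tau>(2) assms(2)]
    show ?thesis
      using has_derivative_closest_point[OF clM m u(1) C less cp] by blast
  qed
  have B: "is_shape_operator M m v B"
    unfolding assms(6) by (rule is_shape_operator_shape_operator[OF m assms(4)])
  have sym: "\<forall>x\<in>?T. \<forall>y\<in>?T. B x \<bullet> y = x \<bullet> B y"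
    using shape_operator_symmetric[OF m assms(4) B] by blast
  note dv = main[OF assms(4) \<tau>(1) B]
  have "is_shape_operator M m 0 (\<lambda>x. 0)"
    by (auto simp: is_shape_operator_def linear_zero subspace_0[OF T])
  moreover have "0 \<in> normal_space_at M m"
    unfolding normal_space_at_def by (rule subspace_0[OF subspace_orthogonal_comp])
  moreover have "norm (0::'a) < \<tau>" using \<tau>(1) norm_ge_zero[of v] by (simp only: norm_zero)
  ultimately have "(closest_point M has_derivative orth_proj ?T \<circ> inv (\<lambda>x. x - 0)) (at (m + 0))"
    using main[of 0 "\<lambda>x. 0"] by blast
  moreover have "inv (\<lambda>x::'a. x) = (\<lambda>x. x)" using inv_id by (simp only: id_def)
  ultimately have d0: "(closest_point M has_derivative orth_proj ?T) (at m)" by (simp add: o_def)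
  \<comment> \<open>With \<open>x = y - B y\<close>, the tangential projection fixes
    \<open>B y\<close>, so the projection of \<open>y\<close> is that of \<open>x\<close> plus
    \<open>B y\<close>.\<close>
  have "orth_proj ?T (inv (\<lambda>x. x - B x) x) = orth_proj ?T x + B (inv (\<lambda>x. x - B x) x)" for x
  proof -
    define y where "y = inv (\<lambda>x. x - B x) x"
    have y: "x = y - B y"
      unfolding y_def using surj_f_inv_f[OF bij_is_surj[OF conjunct1[OF dv]]] by metis
    have "B y = B (orth_proj ?T y)"
    proof -
      have "y - orth_proj ?T y \<in> normal_space_at M m"
        using orth_proj_orthogonal[OF T, of _ y]
        by (auto simp: normal_space_at_def orthogonal_comp_def orthogonal_def inner_commute)
      then have "B (y - orth_proj ?T y) = 0" "linear B" using B by (auto simp: is_shape_operator_def)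
      then show ?thesis by (simp add: linear_diff)
    qed
    then have "B y \<in> ?T" using B orth_proj_in[OF T, of y] by (auto simp: is_shape_operator_def)
    then have "orth_proj ?T x = orth_proj ?T y - B y"
      unfolding y by (simp add: linear_diff[OF linear_orth_proj[OF T]] orth_proj_id[OF T])
    then show ?thesis by (simp add: y_def)
  qed
  then show ?thesis
    using B sym dv d0 frechet_derivative_at[OF conjunct2[OF dv]] frechet_derivative_at[OF d0]
    by (auto simp: differentiable_def fun_eq_iff)
qed

end
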